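(* Let $\nu$ be a probability measure on $\mathcal{P}_2(\mathbb{R}^d)$, and let $V:\mathbb{R}^d\times\mathcal{P}_2(\mathbb{R}^d)\to\mathbb{R}^p$ be a continuous function such that $$\|V\|_{L^2(\nu)}^2:=\int_{\mathcal{P}_2(\mathbb{R}^d)}|V(\cdot,\mu)|_\mu^2\,\nu(\mathrm{d}\mu)<\infty.$$ Then for every $\varepsilon>0$ there exist $k\in\mathbb{N}$, a neural network $\Psi:\mathbb{R}^d\times\mathbb{R}^k\to\mathbb{R}^p$ and a neural network $\varphi:\mathbb{R}^d\to\mathbb{R}^k$ such that $$\int_{\mathcal{P}_2(\mathbb{R}^d)}\big|V(\cdot,\mu)-\Psi(\cdot,\langle\varphi,\mu\rangle)\big|_\mu^2\,\nu(\mathrm{d}\mu)\le\varepsilon.$$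
   Context: $\mathcal{P}_2(\mathbb{R}^d)$ is the Wasserstein space of square-integrable Borel probability measures on $\mathbb{R}^d$, equipped with the 2-Wasserstein distance (and its Borel $\sigma$-algebra); $|\cdot|$ is the Euclidean norm; $d,p\ge1$ are integers. For $\mu\in\mathcal{P}_2(\mathbb{R}^d)$ and a measurable function $\phi$ on $\mathbb{R}^d$ with values in a Euclidean space, $|\phi|_\mu^2:=\int|\phi(x)|^2\mu(\mathrm{d}x)$. For $\varphi:\mathbb{R}^d\to\mathbb{R}^k$, $\langle\varphi,\mu\rangle:=\int\varphi(x)\,\mu(\mathrm{d}x)\in\mathbb{R}^k$. A neural network from $\mathbb{R}^m$ to $\mathbb{R}^q$ is a feedforward network, i.e. a map $A_{L+1}\circ\sigma\circ A_L\circ\cdots\circ\sigma\circ A_1$ with $L\ge1$ hidden layers of arbitrary widths $d_1,\dots,d_L$, where $A_\ell(z)=w_\ell z+b_\ell\in\mathbb{R}^{d_\ell}$ are affine maps ($d_{L+1}=q$), and the activation function $\sigma:\mathbb{R}\to\mathbb{R}$ is applied componentwise; $\sigma$ is fixed to be one of $\tanh$, sigmoid $t\mapsto1/(1+e^{-t})$, or ReLU $t\mapsto\max(t,0)$. *)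

theory Defs
  imports "HOL-Probability.Probability"
begin

section \<open>The Wasserstein space\<close>

definition P2 :: "'a::euclidean_space measure set" where
  "P2 = {\<mu>. prob_space \<mu> \<and> sets \<mu> = sets borel \<and> (\<integral>\<^sup>+x. ennreal ((norm x)\<^sup>2) \<partial>\<mu>) < \<infinity>}"

definition couplings ::
  "'a::euclidean_space measure \<Rightarrow> 'a measure \<Rightarrow> ('a \<times> 'a) measure set" where
  "couplings \<mu> \<mu>' =
     {\<pi>. sets \<pi> = sets borel \<and> distr \<pi> borel fst = \<mu> \<and> distr \<pi> borel snd = \<mu>'}"

text \<open>The cost is finite for the product coupling of two elements of \<^const>\<open>P2\<close>, so
  \<^const>\<open>enn2real\<close> loses nothing there.\<close>

definition W2 :: "'a::euclidean_space measure \<Rightarrow> 'a measure \<Rightarrow> real" where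
  "W2 \<mu> \<mu>' =
     sqrt (enn2real (INF \<pi>\<in>couplings \<mu> \<mu>'. \<integral>\<^sup>+z. ennreal ((norm (fst z - snd z))\<^sup>2) \<partial>\<pi>))"

text \<open>The library's \<^const>\<open>Metric_space.mtopology\<close> unfolds only after the metric axioms for
  \<^const>\<open>W2\<close>, including the triangle inequality, have been proved. The family of sets that
  contain a ball around each of their points is a topology in any case, so it is used directly;
  the second lemma below identifies it with the library's topology.\<close>

definition P2_topology :: "'a::euclidean_space measure topology" where
  "P2_topology =
     topology (\<lambda>U. U \<subseteq> P2 \<and> (\<forall>\<mu>\<in>U. \<exists>r>0. \<forall>\<mu>'\<in>P2. W2 \<mu> \<mu>' < r \<longrightarrow> \<mu>' \<in> U))"

lemma openin_P2_topology:
  fixes U :: "'a::euclidean_space measure set"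
  shows "openin P2_topology U \<longleftrightarrow>
     U \<subseteq> P2 \<and> (\<forall>\<mu>\<in>U. \<exists>r>0. \<forall>\<mu>'\<in>P2. W2 \<mu> \<mu>' < r \<longrightarrow> \<mu>' \<in> U)"
proof -
  let ?op = "\<lambda>U :: 'a measure set. U \<subseteq> P2 \<and> (\<forall>\<mu>\<in>U. \<exists>r>0. \<forall>\<mu>'\<in>P2. W2 \<mu> \<mu>' < r \<longrightarrow> \<mu>' \<in> U)"
  have "istopology ?op"
    unfolding istopology_def
  proof (intro conjI allI impI)
    fix S T :: "'a measure set" assume S: "?op S" and T: "?op T"
    show "S \<inter> T \<subseteq> P2" using S by blast
    show "\<forall>\<mu>\<in>S \<inter> T. \<exists>r>0. \<forall>\<mu>'\<in>P2. W2 \<mu> \<mu>' < r \<longrightarrow> \<mu>' \<in> S \<inter> T"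
    proof
      fix \<mu> assume "\<mu> \<in> S \<inter> T"
      then obtain r s where "r > 0" "\<forall>\<mu>'\<in>P2. W2 \<mu> \<mu>' < r \<longrightarrow> \<mu>' \<in> S"
        and "s > 0" "\<forall>\<mu>'\<in>P2. W2 \<mu> \<mu>' < s \<longrightarrow> \<mu>' \<in> T"
        using S T by blast
      then show "\<exists>r>0. \<forall>\<mu>'\<in>P2. W2 \<mu> \<mu>' < r \<longrightarrow> \<mu>' \<in> S \<inter> T"
        by (intro exI[of _ "min r s"]) auto
    qed
  next
    fix K :: "'a measure set set" assume K: "\<forall>S\<in>K. ?op S"
    show "\<Union>K \<subseteq> P2" using K by blast
    show "\<forall>\<mu>\<in>\<Union>K. \<exists>r>0. \<forall>\<mu>'\<in>P2. W2 \<mu> \<mu>' < r \<longrightarrow> \<mu>' \<in> \<Union>K"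
    proof
      fix \<mu> assume "\<mu> \<in> \<Union>K"
      then obtain S where "S \<in> K" "\<mu> \<in> S" by blast
      with K obtain r where "r > 0" "\<forall>\<mu>'\<in>P2. W2 \<mu> \<mu>' < r \<longrightarrow> \<mu>' \<in> S" by blast
      with \<open>S \<in> K\<close> show "\<exists>r>0. \<forall>\<mu>'\<in>P2. W2 \<mu> \<mu>' < r \<longrightarrow> \<mu>' \<in> \<Union>K" by blast
    qed
  qed
  then show ?thesis
    unfolding P2_topology_def by (simp only: topology_inverse')
qed

lemma P2_topology_eq_mtopology:
  assumes "Metric_space (P2 :: 'a::euclidean_space measure set) W2"
  shows "(P2_topology :: 'a measure topology) = Metric_space.mtopology P2 W2"
proof -
  interpret Metric_space "P2 :: 'a measure set" W2 by (rule assms)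
  show ?thesis
    unfolding topology_eq openin_P2_topology openin_mtopology mball_def by blast
qed

definition P2_borel :: "'a::euclidean_space measure measure" where
  "P2_borel = sigma P2 {U. openin P2_topology U}"

definition sq_norm :: "'a measure \<Rightarrow> ('a \<Rightarrow> 'b::real_normed_vector) \<Rightarrow> ennreal" where
  "sq_norm \<mu> \<phi> = (\<integral>\<^sup>+x. ennreal ((norm (\<phi> x))\<^sup>2) \<partial>\<mu>)"


section \<open>Feedforward neural networks\<close>

text \<open>The dimensions of the hidden layers are quantified inside statements, so they cannot be
  types. A vector indexed by a finite set \<open>J\<close> is an element of \<open>J \<rightarrow>\<^sub>E UNIV\<close>: the space
  \<open>\<real>\<^sup>n\<close> is obtained for \<open>J = {..<n}\<close>, \<open>real^'d\<close> corresponds (via \<^const>\<open>vec_nth\<close>) to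
  \<open>J = UNIV\<close>, and \<open>\<real>\<^sup>d \<times> \<real>\<^sup>k\<close> to the disjoint sum of the two index sets.\<close>

definition affine_layer ::
  "'i set \<Rightarrow> 'j set \<Rightarrow> ('j \<Rightarrow> 'i \<Rightarrow> real) \<Rightarrow> ('j \<Rightarrow> real) \<Rightarrow> ('i \<Rightarrow> real) \<Rightarrow> 'j \<Rightarrow> real" where
  "affine_layer I J w b z = (\<lambda>j\<in>J. (\<Sum>i\<in>I. w j i * z i) + b j)"

definition componentwise :: "(real \<Rightarrow> real) \<Rightarrow> 'j set \<Rightarrow> ('j \<Rightarrow> real) \<Rightarrow> 'j \<Rightarrow> real" where
  "componentwise \<sigma> J z = (\<lambda>j\<in>J. \<sigma> (z j))"

text \<open>\<open>hidden_layers \<sigma> I n H\<close>: the map \<open>H\<close> is \<open>\<sigma> \<circ> A\<^sub>L \<circ> \<dots> \<circ> \<sigma> \<circ> A\<^sub>1\<close> for some \<open>L \<ge> 1\<close>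
  and some positive widths, the last of which is \<open>n\<close>.\<close>

inductive hidden_layers ::
  "(real \<Rightarrow> real) \<Rightarrow> 'i set \<Rightarrow> nat \<Rightarrow> (('i \<Rightarrow> real) \<Rightarrow> nat \<Rightarrow> real) \<Rightarrow> bool"
  for \<sigma> :: "real \<Rightarrow> real" and I :: "'i set" where
  first_layer: "n \<ge> 1 \<Longrightarrow>
    hidden_layers \<sigma> I n (componentwise \<sigma> {..<n} \<circ> affine_layer I {..<n} w b)"
| next_layer: "hidden_layers \<sigma> I m H \<Longrightarrow> n \<ge> 1 \<Longrightarrow>
    hidden_layers \<sigma> I n (componentwise \<sigma> {..<n} \<circ> affine_layer {..<m} {..<n} w b \<circ> H)"

definition neural_network ::
  "(real \<Rightarrow> real) \<Rightarrow> 'i set \<Rightarrow> 'j set \<Rightarrow> (('i \<Rightarrow> real) \<Rightarrow> 'j \<Rightarrow> real) \<Rightarrow> bool" where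
  "neural_network \<sigma> I J f \<longleftrightarrow>
     (\<exists>m H w b. hidden_layers \<sigma> I m H \<and> f = affine_layer {..<m} J w b \<circ> H)"

definition sigmoid :: "real \<Rightarrow> real" where
  "sigmoid t = 1 / (1 + exp (- t))"

definition relu :: "real \<Rightarrow> real" where
  "relu t = max t 0"

text \<open>The vector \<open>\<langle>\<phi>, \<mu>\<rangle>\<close> in \<open>\<real>\<^sup>k\<close>.\<close>

definition mean_embedding ::
  "nat \<Rightarrow> (real^'d \<Rightarrow> nat \<Rightarrow> real) \<Rightarrow> (real^'d) measure \<Rightarrow> nat \<Rightarrow> real" where
  "mean_embedding k \<phi> \<mu> = (\<lambda>i\<in>{..<k}. \<integral>x. \<phi> x i \<partial>\<mu>)"

end

theory Submission
  imports Defs "HOL-Real_Asymp.Real_Asymp"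
begin

text \<open>The error to be bounded is a squared \<open>L\<^sup>2\<close> distance on
  \<open>\<real>\<^sup>d \<times> P2\<close> for the joint law \<open>\<nu>(d\<mu>) \<mu>(dx)\<close> (\<open>joint_law\<close>). The claim is therefore that networks in the
  scalar functions \<open>(x, \<mu>) \<mapsto> x\<^sub>i\<close> and \<open>(x, \<mu>) \<mapsto> \<langle>\<phi>, \<mu>\<rangle>\<close>, with \<open>\<phi>\<close> itself a network on \<open>\<real>\<^sup>d\<close>, are dense in an
  \<open>L\<^sup>2\<close> space to which \<open>V\<close> belongs.

  Density is a statement about \<open>\<sigma>\<close>-algebras only (\<open>net_dense_L2\<close>). Given any set of real features on a finite
  measure space, two hidden layers with a bounded sigmoidal activation converge pointwise to the indicator
  of each finite intersection of sets \<open>{X \<ge> a}\<close> (\<open>orthant_net_limit\<close>): the first layer decides the single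
  inequalities, the second decides whether all of them hold. A Dynkin argument extends this to the indicators
  of all sets in the \<open>\<sigma>\<close>-algebra generated by the features, and simple functions extend it to \<open>L\<^sup>2\<close>. The
  argument is purely measure-theoretic, so it applies on \<open>\<real>\<^sup>d \<times> P2\<close> exactly as on \<open>\<real>\<^sup>d\<close>.
  For \<open>tanh\<close> and ReLU, a bounded sigmoidal function is an affine combination of rescaled and
  shifted copies of the activation.

  It remains to see that \<open>V\<close> is measurable for the \<open>\<sigma>\<close>-algebra generated by the features, and not only for the
  Borel \<open>\<sigma>\<close>-algebra of the Wasserstein distance (\<open>continuous_map_P2_measurable\<close>). Indicators
  of orthants in \<open>\<real>\<^sup>d\<close> are bounded pointwise limits of networks \<open>\<phi>\<close>, so every \<open>\<mu> \<mapsto> \<mu>(A)\<close> is measurable for the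
  features (\<open>snd_feature_space\<close>). Let \<open>r\<^sub>n\<close> be simple functions converging to the identity of \<open>\<real>\<^sup>d\<close>. The image of
  \<open>\<mu>\<close> under \<open>r\<^sub>n\<close> converges to \<open>\<mu>\<close> in \<open>W2\<close>, and so do, for fixed \<open>n\<close>, the measures with the same atoms and weights
  rounded to multiples of \<open>1/k\<close> towards that image. Along these approximations \<open>V\<close> converges by
  continuity, and the rounded measures take countably many values and depend only on finitely many
  numbers \<open>\<mu>(A)\<close>. All couplings are explicit images of one measure under a pair of maps
  (\<open>coupling_distr\<close>), and the two limits are taken one after the other, so that each is a convergence to a fixed measure.

  Conversely, the features have to be measurable for the Borel \<open>\<sigma>\<close>-algebra on which \<open>\<nu>\<close> lives. This holds because a
  bounded Lipschitz function has a \<open>W2\<close>-continuous integral (\<open>integral_lipschitz_coupling\<close>).\<close>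

section \<open>Networks over arbitrary input functions\<close>

text \<open>Networks are treated as real functions on an arbitrary set, built from a set \<open>C\<close> of input functions
  which takes the place of the coordinates. Layers become closure operations on sets of functions, with no widths or
  weight matrices; these reappear only in \<open>net_is_neural_network\<close>.\<close>

inductive_set affine_span :: "('a \<Rightarrow> real) set \<Rightarrow> ('a \<Rightarrow> real) set"
  for C :: "('a \<Rightarrow> real) set" where
  gen: "f \<in> C \<Longrightarrow> f \<in> affine_span C"
| const: "(\<lambda>_. c) \<in> affine_span C"
| add: "f \<in> affine_span C \<Longrightarrow> g \<in> affine_span C \<Longrightarrow> (\<lambda>z. f z + g z) \<in> affine_span C"
| scale: "f \<in> affine_span C \<Longrightarrow> (\<lambda>z. c * f z) \<in> affine_span C"

definition units :: "(real \<Rightarrow> real) \<Rightarrow> ('a \<Rightarrow> real) set \<Rightarrow> ('a \<Rightarrow> real) set" where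
  "units \<sigma> C = (\<lambda>f z. \<sigma> (f z)) ` affine_span C"

definition net :: "(real \<Rightarrow> real) \<Rightarrow> ('a \<Rightarrow> real) set \<Rightarrow> ('a \<Rightarrow> real) set" where
  "net \<sigma> C = affine_span (units \<sigma> (units \<sigma> C))"

lemma affine_span_subset:
  assumes "D \<subseteq> affine_span C" shows "affine_span D \<subseteq> affine_span C"
proof
  fix f assume "f \<in> affine_span D"
  then show "f \<in> affine_span C"
    by induction (use assms in \<open>auto intro: affine_span.intros\<close>)
qed

lemma affine_span_mono: "D \<subseteq> C \<Longrightarrow> affine_span D \<subseteq> affine_span C"
  by (rule affine_span_subset) (auto intro: affine_span.gen)

lemma units_mono: "D \<subseteq> C \<Longrightarrow> units \<sigma> D \<subseteq> units \<sigma> C"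
  unfolding units_def using affine_span_mono by blast

lemma affine_span_sum:
  assumes "\<And>i. i \<in> I \<Longrightarrow> f i \<in> affine_span C"
  shows "(\<lambda>z. \<Sum>i\<in>I. f i z) \<in> affine_span C"
  using assms
proof (induction I rule: infinite_finite_induct)
  case (insert i I)
  then have "(\<lambda>z. f i z + (\<Sum>i\<in>I. f i z)) \<in> affine_span C"
    by (intro affine_span.add) auto
  with insert show ?case by simp
qed (auto intro: affine_span.const[of 0])

text \<open>A function in the span uses finitely many of the possibly infinitely many inputs. Tracing this
  through both layers gives \<open>net_finite_family\<close>, by which finitely many networks can share their inputs.\<close>

lemma affine_span_finite:
  assumes "f \<in> affine_span C"
  shows "\<exists>F. finite F \<and> F \<subseteq> C \<and> f \<in> affine_span F"
  using assms
proof induction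
  case (gen f)
  then show ?case by (intro exI[of _ "{f}"]) (auto intro: affine_span.gen)
next
  case (const c)
  show ?case by (intro exI[of _ "{}"]) (auto intro: affine_span.const)
next
  case (add f g)
  then obtain F G where F: "finite F" "F \<subseteq> C" "f \<in> affine_span F"
    and G: "finite G" "G \<subseteq> C" "g \<in> affine_span G" by blast
  have "f \<in> affine_span (F \<union> G)" "g \<in> affine_span (F \<union> G)"
    using F(3) G(3) affine_span_mono[of F "F \<union> G"] affine_span_mono[of G "F \<union> G"] by auto
  then show ?case using F G by (intro exI[of _ "F \<union> G"]) (auto intro: affine_span.add)
next
  case (scale f c)
  then show ?case by (blast intro: affine_span.scale)
qed

lemma affine_span_finite_family:
  assumes "finite J" "\<And>j. j \<in> J \<Longrightarrow> f j \<in> affine_span C"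
  shows "\<exists>F. finite F \<and> F \<subseteq> C \<and> (\<forall>j\<in>J. f j \<in> affine_span F)"
proof -
  have "\<forall>j\<in>J. \<exists>F. finite F \<and> F \<subseteq> C \<and> f j \<in> affine_span F"
    using affine_span_finite assms(2) by blast
  then obtain F where F: "\<And>j. j \<in> J \<Longrightarrow> finite (F j) \<and> F j \<subseteq> C \<and> f j \<in> affine_span (F j)"
    by metis
  have "f j \<in> affine_span (\<Union>j\<in>J. F j)" if "j \<in> J" for j
    using F[OF that] affine_span_mono[of "F j" "\<Union>j\<in>J. F j"] that by blast
  then show ?thesis using F assms(1) by (intro exI[of _ "\<Union>j\<in>J. F j"]) auto
qed

lemma units_finite_family:
  assumes "finite G" "G \<subseteq> units \<sigma> C"
  shows "\<exists>F. finite F \<and> F \<subseteq> C \<and> G \<subseteq> units \<sigma> F"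
proof -
  have "\<forall>g\<in>G. \<exists>f. f \<in> affine_span C \<and> g = (\<lambda>z. \<sigma> (f z))"
    using assms(2) by (auto simp: units_def)
  then obtain f where f: "\<And>g. g \<in> G \<Longrightarrow> f g \<in> affine_span C \<and> g = (\<lambda>z. \<sigma> (f g z))"
    by metis
  obtain F where "finite F" "F \<subseteq> C" "\<forall>g\<in>G. f g \<in> affine_span F"
    using affine_span_finite_family[of G f C] assms(1) f by blast
  then show ?thesis using f unfolding units_def by blast
qed

lemma net_finite_family:
  assumes "finite J" "\<And>j. j \<in> J \<Longrightarrow> f j \<in> net \<sigma> C"
  shows "\<exists>F. finite F \<and> F \<subseteq> C \<and> (\<forall>j\<in>J. f j \<in> net \<sigma> F)"
proof -
  obtain G2 where G2: "finite G2" "G2 \<subseteq> units \<sigma> (units \<sigma> C)" "\<forall>j\<in>J. f j \<in> affine_span G2"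
    using affine_span_finite_family[of J f "units \<sigma> (units \<sigma> C)"] assms unfolding net_def by blast
  obtain G1 where G1: "finite G1" "G1 \<subseteq> units \<sigma> C" "G2 \<subseteq> units \<sigma> G1"
    using units_finite_family[OF G2(1,2)] by blast
  obtain F where F: "finite F" "F \<subseteq> C" "G1 \<subseteq> units \<sigma> F"
    using units_finite_family[OF G1(1,2)] by blast
  have "affine_span G2 \<subseteq> net \<sigma> F"
    unfolding net_def using G1(3) units_mono[OF F(3)] by (intro affine_span_mono) blast
  then show ?thesis using F G2(3) by blast
qed

lemma affine_span_image_form:
  assumes "finite I" "f \<in> affine_span (h ` I)"
  shows "\<exists>w b. \<forall>z. f z = (\<Sum>i\<in>I. w i * h i z) + b"
  using assms(2)
proof induction
  case (gen f)
  then obtain j where j: "j \<in> I" "f = h j" by blast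
  have "(\<Sum>i\<in>I. (if i = j then 1 else 0) * h i z) = h j z" for z
    using assms(1) j(1) by (simp add: if_distrib[of "\<lambda>c. c * _"] cong: if_cong)
  then show ?case using j by (intro exI[of _ "\<lambda>i. if i = j then 1 else 0"] exI[of _ 0]) simp
next
  case (const c)
  show ?case by (intro exI[of _ "\<lambda>_. 0"] exI[of _ c]) simp
next
  case (add f g)
  then obtain w b v c where "\<And>z. f z = (\<Sum>i\<in>I. w i * h i z) + b"
    "\<And>z. g z = (\<Sum>i\<in>I. v i * h i z) + c" by blast
  then show ?case
    by (intro exI[of _ "\<lambda>i. w i + v i"] exI[of _ "b + c"])
      (simp add: algebra_simps sum.distrib)
next
  case (scale f c)
  then obtain w b where "\<And>z. f z = (\<Sum>i\<in>I. w i * h i z) + b" by blast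
  then show ?case
    by (intro exI[of _ "\<lambda>i. c * w i"] exI[of _ "c * b"])
      (simp add: algebra_simps sum_distrib_left)
qed

lemma units_enumerate:
  assumes "finite I" "finite G" "G \<noteq> {}" "G \<subseteq> units \<sigma> (h ` I)"
  shows "\<exists>n g w b. 1 \<le> (n::nat) \<and> G = g ` {..<n} \<and>
    (\<forall>a<n. \<forall>z. g a z = \<sigma> ((\<Sum>i\<in>I. w a i * h i z) + b a))"
proof -
  obtain g where g: "bij_betw g {..<card G} G"
    using ex_bij_betw_nat_finite[OF assms(2)] by (auto simp: lessThan_atLeast0)
  have "\<forall>a\<in>{..<card G}. \<exists>w b. \<forall>z. g a z = \<sigma> ((\<Sum>i\<in>I. w i * h i z) + b)"
  proof
    fix a assume "a \<in> {..<card G}"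
    then have "g a \<in> units \<sigma> (h ` I)" using g assms(4) by (auto simp: bij_betw_def)
    then obtain f where "f \<in> affine_span (h ` I)" "g a = (\<lambda>z. \<sigma> (f z))"
      by (auto simp: units_def)
    then show "\<exists>w b. \<forall>z. g a z = \<sigma> ((\<Sum>i\<in>I. w i * h i z) + b)"
      using affine_span_image_form[OF assms(1)] by metis
  qed
  then obtain w b where "\<And>a z. a < card G \<Longrightarrow> g a z = \<sigma> ((\<Sum>i\<in>I. w a i * h i z) + b a)"
    by (metis lessThan_iff)
  moreover have "1 \<le> card G" using assms(2,3) by (simp add: Suc_le_eq card_gt_0_iff)
  moreover have "G = g ` {..<card G}" using g by (auto simp: bij_betw_def)
  ultimately show ?thesis by blast
qed

text \<open>The passage from function spaces back to weight matrices. All components of the output are fed by the same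
  units: the finitely many units of either layer used by some component are collected and enumerated, and the
  weights of a component on units which it does not use are zero.\<close>

lemma net_is_neural_network:
  fixes h :: "'i \<Rightarrow> 'a \<Rightarrow> real" and f :: "'j \<Rightarrow> 'a \<Rightarrow> real"
  assumes "finite I" "finite J" "\<And>j. j \<in> J \<Longrightarrow> f j \<in> net \<sigma> (h ` I)"
  shows "\<exists>\<Psi>. neural_network \<sigma> I J \<Psi> \<and>
    (\<forall>z \<omega>. (\<forall>i\<in>I. z i = h i \<omega>) \<longrightarrow> (\<forall>j\<in>J. \<Psi> z j = f j \<omega>))"
proof -
  obtain G' where G': "finite G'" "G' \<subseteq> units \<sigma> (units \<sigma> (h ` I))" "\<forall>j\<in>J. f j \<in> affine_span G'"
    using affine_span_finite_family[of J f "units \<sigma> (units \<sigma> (h ` I))"] assms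
    unfolding net_def by blast
  \<comment> \<open>A dummy unit keeps both widths positive, as the layers require.\<close>
  have ne: "(\<lambda>_. \<sigma> 0) \<in> units \<sigma> C" for C :: "('a \<Rightarrow> real) set"
    unfolding units_def using affine_span.const[of 0 C] by (rule rev_image_eqI) simp
  define G where "G = insert (\<lambda>_. \<sigma> 0) G'"
  have G: "finite G" "G \<noteq> {}" "G \<subseteq> units \<sigma> (units \<sigma> (h ` I))"
    unfolding G_def using G' ne by auto
  have fG: "f j \<in> affine_span G" if "j \<in> J" for j
    using G'(3) affine_span_mono[of G' G] that unfolding G_def by blast
  obtain F' where F': "finite F'" "F' \<subseteq> units \<sigma> (h ` I)" "G \<subseteq> units \<sigma> F'"
    using units_finite_family[OF G(1,3)] by blast
  define F where "F = insert (\<lambda>_. \<sigma> 0) F'"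
  have F: "finite F" "F \<noteq> {}" "F \<subseteq> units \<sigma> (h ` I)"
    unfolding F_def using F' ne by auto
  have GF: "G \<subseteq> units \<sigma> F"
    using F'(3) units_mono[of F' F \<sigma>] unfolding F_def by blast
  obtain n u w1 b1 where n: "1 \<le> (n::nat)" "F = u ` {..<n}"
    and u: "\<And>a z. a < n \<Longrightarrow> u a z = \<sigma> ((\<Sum>i\<in>I. w1 a i * h i z) + b1 a)"
    using units_enumerate[OF assms(1) F] by metis
  obtain m v w2 b2 where m: "1 \<le> (m::nat)" "G = v ` {..<m}"
    and v: "\<And>a z. a < m \<Longrightarrow> v a z = \<sigma> ((\<Sum>i<n. w2 a i * u i z) + b2 a)"
    using units_enumerate[of "{..<n}" G \<sigma> u] G GF n(2) by (metis finite_lessThan)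
  have "\<forall>j\<in>J. \<exists>w b. \<forall>z. f j z = (\<Sum>i<m. w i * v i z) + b"
    using affine_span_image_form[of "{..<m}" _ v] fG m(2) by simp
  then obtain w3 b3 where f: "\<And>j z. j \<in> J \<Longrightarrow> f j z = (\<Sum>i<m. w3 j i * v i z) + b3 j"
    by metis
  define U where "U = componentwise \<sigma> {..<n} \<circ> affine_layer I {..<n} w1 b1"
  define H where "H = componentwise \<sigma> {..<m} \<circ> affine_layer {..<n} {..<m} w2 b2 \<circ> U"
  have "neural_network \<sigma> I J (affine_layer {..<m} J w3 b3 \<circ> H)"
    unfolding neural_network_def H_def U_def
    using hidden_layers.next_layer[OF hidden_layers.first_layer[OF n(1)] m(1)] by blast
  moreover have "affine_layer {..<m} J w3 b3 (H z) j = f j \<omega>"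
    if z: "\<forall>i\<in>I. z i = h i \<omega>" and j: "j \<in> J" for z \<omega> j
  proof -
    have "U z a = u a \<omega>" if "a < n" for a
      using that z u by (simp add: U_def componentwise_def affine_layer_def cong: sum.cong_simp)
    then have 3: "H z a = v a \<omega>" if "a < m" for a
      using that v by (simp add: H_def componentwise_def affine_layer_def cong: sum.cong_simp)
    show ?thesis using j 3 f by (simp add: affine_layer_def)
  qed
  ultimately show ?thesis by (intro exI[of _ "affine_layer {..<m} J w3 b3 \<circ> H"]) auto
qed

section \<open>Squashing functions and the three activations\<close>

definition squashing :: "(real \<Rightarrow> real) \<Rightarrow> bool" where
  "squashing s \<longleftrightarrow> (\<exists>L. L-lipschitz_on UNIV s) \<and> (\<forall>t. \<bar>s t\<bar> \<le> 1) \<and>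
     (s \<longlongrightarrow> 0) at_bot \<and> (s \<longlongrightarrow> 1) at_top"

text \<open>If one unit of \<open>s\<close> is an affine combination of units of \<open>\<sigma>\<close> with the same inputs, then replacing units layer
  by layer does not change the depth: the affine combinations are absorbed by the affine maps of the next layer.\<close>

lemma net_subset_net:
  assumes "\<And>D f. f \<in> affine_span D \<Longrightarrow> (\<lambda>z. s (f z)) \<in> affine_span (units \<sigma> (D :: ('a \<Rightarrow> real) set))"
  shows "net s C \<subseteq> net \<sigma> (C :: ('a \<Rightarrow> real) set)"
proof -
  have *: "units s D \<subseteq> affine_span (units \<sigma> D)" for D :: "('a \<Rightarrow> real) set"
    using assms unfolding units_def by blast
  have "affine_span (units s C) \<subseteq> affine_span (units \<sigma> C)"
    by (rule affine_span_subset) (rule *)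
  then have "units s (units s C) \<subseteq> units s (units \<sigma> C)"
    unfolding units_def by blast
  also have "\<dots> \<subseteq> net \<sigma> C" unfolding net_def by (rule *)
  finally show ?thesis unfolding net_def by (rule affine_span_subset)
qed

lemma sigmoid_eq_tanh: "sigmoid t = 1/2 * tanh (1/2 * t) + 1/2"
proof -
  have "1 + exp (- t) \<noteq> 0" using exp_gt_zero[of "-t"] by linarith
  then show ?thesis unfolding sigmoid_def tanh_real_altdef by (simp add: field_simps)
qed

lemma squashing_sigmoid: "squashing sigmoid"
  unfolding squashing_def
proof (intro conjI allI exI)
  have pos: "0 < 1 + exp (- t)" for t :: real using exp_gt_zero[of "-t"] by linarith
  show "1-lipschitz_on UNIV sigmoid"
  proof (rule bounded_derivative_imp_lipschitz)
    fix t :: real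
    show "(sigmoid has_derivative (*) (exp (- t) / (1 + exp (- t))\<^sup>2)) (at t within UNIV)"
      unfolding sigmoid_def has_field_derivative_def[symmetric]
      using pos[of t] by (auto intro!: derivative_eq_intros simp: power2_eq_square)
    have "1 * exp (- t) \<le> (1 + exp (- t))\<^sup>2"
      unfolding power2_eq_square using exp_gt_zero[of "-t"] by (intro mult_mono) auto
    then have le: "exp (- t) / (1 + exp (- t))\<^sup>2 \<le> 1" using pos[of t] by simp
    show "onorm ((*) (exp (- t) / (1 + exp (- t))\<^sup>2)) \<le> 1"
    proof (rule onorm_bound)
      fix x :: real
      show "norm (exp (- t) / (1 + exp (- t))\<^sup>2 * x) \<le> 1 * norm x"
        unfolding norm_mult using le by (intro mult_right_mono) auto
    qed simp
  qed auto
  show "\<bar>sigmoid t\<bar> \<le> 1" for t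
    unfolding sigmoid_def using pos[of t] by simp
  show "(sigmoid \<longlongrightarrow> 0) at_bot" unfolding sigmoid_def by real_asymp
  show "(sigmoid \<longlongrightarrow> 1) at_top" unfolding sigmoid_def by real_asymp
qed

lemma relu_lipschitz: "1-lipschitz_on UNIV relu"
  unfolding relu_def by (rule lipschitz_onI) (auto simp: dist_real_def)

lemma squashing_ramp: "squashing (\<lambda>t. relu (t + 1) - relu t)"
  unfolding squashing_def
proof (intro conjI allI exI)
  show "(1 * 1 + 1)-lipschitz_on UNIV (\<lambda>t. relu (t + 1) - relu t)"
  proof (intro lipschitz_on_diff relu_lipschitz)
    have "1-lipschitz_on UNIV (\<lambda>t::real. t + 1)" by (rule lipschitz_onI) (auto simp: dist_real_def)
    then show "(1 * 1)-lipschitz_on UNIV (\<lambda>t. relu (t + 1))"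
      by (rule lipschitz_on_compose2) (rule lipschitz_on_subset[OF relu_lipschitz], simp)
  qed
  show "\<bar>relu (t + 1) - relu t\<bar> \<le> 1" for t unfolding relu_def by auto
  show "((\<lambda>t. relu (t + 1) - relu t) \<longlongrightarrow> 0) at_bot"
    by (rule tendsto_eventually, rule eventually_mono[OF eventually_le_at_bot[of "-1"]])
      (auto simp: relu_def)
  show "((\<lambda>t. relu (t + 1) - relu t) \<longlongrightarrow> 1) at_top"
    by (rule tendsto_eventually, rule eventually_mono[OF eventually_ge_at_top[of "0"]])
      (auto simp: relu_def)
qed

text \<open>ReLU is unbounded, but the ramp \<open>relu (t + 1) - relu t\<close> is squashing and costs two units; the sigmoid
  costs one rescaled unit of \<open>tanh\<close>. Approximation is therefore carried out with a squashing \<open>s\<close> throughout, which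
  makes all networks bounded and Lipschitz.\<close>

lemma net_sigmoid_subset_tanh: "net sigmoid C \<subseteq> net tanh C"
proof (rule net_subset_net)
  fix D and f :: "'a \<Rightarrow> real" assume f: "f \<in> affine_span D"
  have "(\<lambda>z. tanh (1/2 * f z)) \<in> units tanh D"
    using affine_span.scale[OF f, of "1/2"] unfolding units_def by (rule rev_image_eqI) (rule refl)
  then have "(\<lambda>z. 1/2 * tanh (1/2 * f z) + 1/2) \<in> affine_span (units tanh D)"
    by (intro affine_span.add affine_span.scale affine_span.const affine_span.gen)
  then show "(\<lambda>z. sigmoid (f z)) \<in> affine_span (units tanh D)"
    by (simp only: sigmoid_eq_tanh)
qed

lemma net_ramp_subset_relu: "net (\<lambda>t. relu (t + 1) - relu t) C \<subseteq> net relu C"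
proof (rule net_subset_net)
  fix D and f :: "'a \<Rightarrow> real" assume f: "f \<in> affine_span D"
  have "(\<lambda>z. relu (f z + 1)) \<in> units relu D" "(\<lambda>z. relu (f z)) \<in> units relu D"
    using affine_span.add[OF f affine_span.const[of 1]] f unfolding units_def
    by (auto intro: rev_image_eqI)
  then have "(\<lambda>z. relu (f z + 1) + (-1) * relu (f z)) \<in> affine_span (units relu D)"
    by (intro affine_span.add affine_span.scale affine_span.gen)
  then show "(\<lambda>z. relu (f z + 1) - relu (f z)) \<in> affine_span (units relu D)" by simp
qed

lemma ex_squashing_net:
  assumes "\<sigma> \<in> {tanh, sigmoid, relu}"
  shows "\<exists>s. squashing s \<and> (\<forall>C :: ('a \<Rightarrow> real) set. net s C \<subseteq> net \<sigma> C) \<and>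
    (\<forall>C :: ('b \<Rightarrow> real) set. net s C \<subseteq> net \<sigma> C)"
proof -
  consider "\<sigma> = tanh" | "\<sigma> = sigmoid" | "\<sigma> = relu" using assms by blast
  then show ?thesis
  proof cases
    case 1
    show ?thesis unfolding 1
      by (intro exI[of _ sigmoid] conjI allI squashing_sigmoid net_sigmoid_subset_tanh)
  next
    case 2
    show ?thesis unfolding 2
      by (intro exI[of _ sigmoid] conjI allI squashing_sigmoid subset_refl)
  next
    case 3
    show ?thesis unfolding 3
      by (intro exI[of _ "\<lambda>t. relu (t + 1) - relu t"] conjI allI squashing_ramp net_ramp_subset_relu)
  qed
qed

lemma squashing_measurable:
  assumes "squashing s" shows "s \<in> borel_measurable borel"
proof -
  have "continuous_on UNIV s" using assms lipschitz_on_continuous_on unfolding squashing_def by blast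
  then show ?thesis by (rule borel_measurable_continuous_onI)
qed

lemma affine_span_bounded:
  assumes "f \<in> affine_span C" "\<And>g. g \<in> C \<Longrightarrow> \<exists>B. \<forall>z. \<bar>g z\<bar> \<le> B"
  shows "\<exists>B. \<forall>z. \<bar>f z :: real\<bar> \<le> B"
  using assms(1)
proof induction
  case (add f g)
  then obtain A B where "\<And>z. \<bar>f z\<bar> \<le> A" "\<And>z. \<bar>g z\<bar> \<le> B" by blast
  then show ?case by (intro exI[of _ "A + B"]) (meson abs_triangle_ineq add_mono order_trans)
next
  case (scale f c)
  then obtain A where "\<And>z. \<bar>f z\<bar> \<le> A" by blast
  then show ?case by (intro exI[of _ "\<bar>c\<bar> * A"]) (simp add: abs_mult mult_left_mono)
qed (use assms(2) in auto)

lemma net_bounded: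
  assumes "squashing s" "f \<in> net s C"
  shows "\<exists>B. \<forall>z. \<bar>f z\<bar> \<le> B"
  using assms unfolding net_def units_def squashing_def
  by (elim affine_span_bounded) (auto intro!: exI[of _ 1])

lemma affine_span_measurable:
  assumes "f \<in> affine_span C" "C \<subseteq> borel_measurable M"
  shows "f \<in> borel_measurable M"
  using assms(1) by induction (use assms(2) in auto)

lemma net_measurable:
  assumes "squashing s" "f \<in> net s C" "C \<subseteq> borel_measurable M"
  shows "f \<in> borel_measurable M"
proof -
  have *: "units s D \<subseteq> borel_measurable M" if "D \<subseteq> borel_measurable M" for D
    unfolding units_def
    using measurable_compose[OF affine_span_measurable[OF _ that] squashing_measurable[OF assms(1)]]
    by (rule image_subsetI)
  show ?thesis
    using assms(2) unfolding net_def by (rule affine_span_measurable) (intro * assms(3))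
qed

lemma affine_span_lipschitz:
  fixes C :: "('a::metric_space \<Rightarrow> real) set"
  assumes "f \<in> affine_span C" "\<And>g. g \<in> C \<Longrightarrow> \<exists>L. L-lipschitz_on UNIV g"
  shows "\<exists>L. L-lipschitz_on UNIV f"
  using assms(1)
  by induction
    (use assms(2) in \<open>auto intro: lipschitz_on_constant lipschitz_on_add lipschitz_on_cmult_real\<close>)

lemma net_lipschitz:
  fixes C :: "('a::metric_space \<Rightarrow> real) set"
  assumes "squashing s" "f \<in> net s C" "\<And>g. g \<in> C \<Longrightarrow> \<exists>L. L-lipschitz_on UNIV g"
  shows "\<exists>L. L-lipschitz_on UNIV f"
proof -
  obtain L where L: "L-lipschitz_on UNIV s" using assms(1) unfolding squashing_def by blast
  have *: "\<forall>g\<in>units s D. \<exists>L. L-lipschitz_on UNIV g"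
    if "\<forall>g\<in>D. \<exists>L. L-lipschitz_on UNIV g" for D :: "('a \<Rightarrow> real) set"
  proof
    fix g assume "g \<in> units s D"
    then obtain f where f: "f \<in> affine_span D" "g = (\<lambda>z. s (f z))" by (auto simp: units_def)
    have "\<exists>K. K-lipschitz_on UNIV f" by (rule affine_span_lipschitz[OF f(1)]) (use that in blast)
    then obtain K where "K-lipschitz_on UNIV f" by blast
    then have "(L * K)-lipschitz_on UNIV g"
      unfolding f(2) by (rule lipschitz_on_compose2) (rule lipschitz_on_subset[OF L], simp)
    then show "\<exists>L. L-lipschitz_on UNIV g" by blast
  qed
  have "\<forall>g\<in>units s (units s C). \<exists>L. L-lipschitz_on UNIV g" by (intro *) (use assms(3) in blast)
  then show ?thesis using assms(2) affine_span_lipschitz unfolding net_def by blast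
qed

section \<open>Density of networks in L2\<close>

text \<open>The first layer converges to the indicators of the sets \<open>{X \<ge> a}\<close>, so the sum of its units converges to the
  number of inequalities that hold; the second layer compares this integer with the total number \<open>card F\<close>.\<close>

lemma orthant_net_limit:
  assumes s: "squashing s" and F: "finite F" "F \<subseteq> C \<times> UNIV"
  shows "\<exists>f. (\<forall>n::nat. f n \<in> net s C) \<and> (\<forall>n z. \<bar>f n z\<bar> \<le> 1) \<and>
    (\<forall>z. (\<lambda>n. f n z) \<longlonglongrightarrow> (if \<forall>(X, a)\<in>F. a \<le> X z then 1 else 0 :: real))"
proof -
  have bot: "(s \<longlongrightarrow> 0) at_bot" and top: "(s \<longlongrightarrow> 1) at_top" and bd: "\<And>t. \<bar>s t\<bar> \<le> 1"
    using s by (auto simp: squashing_def)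
  \<comment> \<open>With \<open>t = X z - a\<close> the argument of \<open>s\<close> is \<open>n (n t + 1)\<close>: the \<open>1\<close> sends the boundary case \<open>t = 0\<close> to
    infinity as well, and is negligible against \<open>n t\<close> when \<open>t < 0\<close>.\<close>
  define u where "u n p z = s (real n * (real n * (fst p z + (- snd p)) + 1))" 
    for n :: nat and p :: "('a \<Rightarrow> real) \<times> real" and z
  \<comment> \<open>Counts are integers, so the threshold \<open>card F - 1/2\<close> separates \<open>card F\<close> from all smaller ones.\<close>
  define f where "f n z = s (real n * ((\<Sum>p\<in>F. u n p z) + (1/2 - real (card F))))" for n :: nat and z
  have u_lim: "(\<lambda>n. u n p z) \<longlonglongrightarrow> (if snd p \<le> fst p z then 1 else 0)" for p z
  proof -
    define t where "t = fst p z + (- snd p)"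
    have "filterlim (\<lambda>n. real n * (real n * t + 1)) at_top sequentially" if "t \<ge> 0"
    proof (rule filterlim_at_top_mono[OF filterlim_real_sequentially])
      show "\<forall>\<^sub>F n in sequentially. real n \<le> real n * (real n * t + 1)"
        using that by (intro always_eventually allI) (simp add: algebra_simps)
    qed
    moreover have "filterlim (\<lambda>n. real n * (real n * t + 1)) at_bot sequentially" if "t < 0"
      using that by real_asymp
    ultimately have "(\<lambda>n. s (real n * (real n * t + 1))) \<longlonglongrightarrow> (if t \<ge> 0 then 1 else 0)"
      using filterlim_compose[OF top] filterlim_compose[OF bot] by (cases "t \<ge> 0") auto
    then show ?thesis unfolding u_def t_def by (simp add: algebra_simps)
  qed
  have "f n \<in> net s C" for n
  proof -
    have "u n p \<in> units s C" if "p \<in> F" for p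
    proof -
      have "(\<lambda>z. real n * (real n * (fst p z + (- snd p)) + 1)) \<in> affine_span C"
        using that F(2) by (intro affine_span.intros) auto
      then show ?thesis unfolding units_def u_def by (rule rev_image_eqI) auto
    qed
    then have "(\<lambda>z. real n * ((\<Sum>p\<in>F. u n p z) + (1/2 - real (card F)))) \<in> affine_span (units s C)"
      by (intro affine_span.add affine_span.scale affine_span.const affine_span_sum affine_span.gen)
    then have "f n \<in> units s (units s C)" unfolding units_def f_def[abs_def] 
      by (rule imageI)
    then show ?thesis unfolding net_def by (rule affine_span.gen)
  qed
  moreover have "(\<lambda>n. f n z) \<longlonglongrightarrow> (if \<forall>(X, a)\<in>F. a \<le> X z then 1 else 0)" for z
  proof -
    define N where "N = {p\<in>F. snd p \<le> fst p z}"
    have N: "finite N" "N \<subseteq> F" using F(1) by (auto simp: N_def)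
    have "(\<lambda>n. (\<Sum>p\<in>F. u n p z)) \<longlonglongrightarrow> (\<Sum>p\<in>F. if snd p \<le> fst p z then 1 else 0)"
      by (intro tendsto_sum u_lim)
    also have "(\<Sum>p\<in>F. if snd p \<le> fst p z then 1 else 0) = real (card N)"
      using F(1) by (simp add: sum.If_cases N_def Int_def)
    finally have lim: "(\<lambda>n. (\<Sum>p\<in>F. u n p z) + (1/2 - real (card F))) \<longlonglongrightarrow>
        real (card N) + (1/2 - real (card F))"
      by (intro tendsto_add tendsto_const)
    show ?thesis
    proof (cases "\<forall>(X, a)\<in>F. a \<le> X z")
      case True
      then have "N = F" by (auto simp: N_def)
      then have "0 < real (card N) + (1/2 - real (card F))" by simp
      with lim have "filterlim (\<lambda>n. ((\<Sum>p\<in>F. u n p z) + (1/2 - real (card F))) * real n) at_top sequentially"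
        by (intro filterlim_tendsto_pos_mult_at_top filterlim_real_sequentially)
      then have "filterlim (\<lambda>n. real n * ((\<Sum>p\<in>F. u n p z) + (1/2 - real (card F)))) at_top sequentially"
        by (simp only: mult.commute)
      from filterlim_compose[OF top this] show ?thesis using True unfolding f_def by simp
    next
      case False
      then obtain X a where "(X, a) \<in> F" "\<not> a \<le> X z" by blast
      then have "(X, a) \<in> F - N" by (simp add: N_def)
      then have "N \<subset> F" using N(2) by blast
      then have "card N < card F" using F(1) by (rule psubset_card_mono[rotated])
      then have "real (card N) + (1/2 - real (card F)) < 0" by linarith
      with lim have "filterlim (\<lambda>n. ((\<Sum>p\<in>F. u n p z) + (1/2 - real (card F))) * real n) at_bot sequentially"
        by (intro filterlim_tendsto_neg_mult_at_bot filterlim_real_sequentially)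
      then have "filterlim (\<lambda>n. real n * ((\<Sum>p\<in>F. u n p z) + (1/2 - real (card F)))) at_bot sequentially"
        by (simp only: mult.commute)
      from filterlim_compose[OF bot this] show ?thesis unfolding f_def by (simp only: False if_False)
    qed
  qed
  moreover have "\<bar>f n z\<bar> \<le> 1" for n z unfolding f_def by (rule bd)
  ultimately show ?thesis by (intro exI[of _ f]) auto
qed

definition orthants :: "'a set \<Rightarrow> ('a \<Rightarrow> real) set \<Rightarrow> 'a set set" where
  "orthants \<Omega> C = {{z\<in>\<Omega>. \<forall>(X, a)\<in>F. a \<le> X z} | F. finite F \<and> F \<subseteq> C \<times> UNIV}"

lemma Int_stable_orthants: "Int_stable (orthants \<Omega> C)"
proof (rule Int_stableI)
  fix A B assume "A \<in> orthants \<Omega> C" "B \<in> orthants \<Omega> C"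
  then obtain F1 F2 where F: "finite F1" "F1 \<subseteq> C \<times> UNIV" "A = {z\<in>\<Omega>. \<forall>(X, a)\<in>F1. a \<le> X z}"
    "finite F2" "F2 \<subseteq> C \<times> UNIV" "B = {z\<in>\<Omega>. \<forall>(X, a)\<in>F2. a \<le> X z}"
    unfolding orthants_def by blast
  then show "A \<inter> B \<in> orthants \<Omega> C"
    unfolding orthants_def by (intro CollectI exI[of _ "F1 \<union> F2"]) auto
qed

lemma sigma_sets_orthants:
  "sigma_sets \<Omega> {{z\<in>\<Omega>. a \<le> X z} | X a. X \<in> C} = sigma_sets \<Omega> (orthants \<Omega> C)"
proof (rule sigma_sets_eqI)
  let ?H = "{{z\<in>\<Omega>. a \<le> X z} | X a. X \<in> C}"
  interpret sigma_algebra \<Omega> "sigma_sets \<Omega> ?H" by (rule sigma_algebra_sigma_sets) auto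
  show "A \<in> sigma_sets \<Omega> (orthants \<Omega> C)" if A: "A \<in> ?H" for A
  proof -
    obtain X a where "X \<in> C" "A = {z\<in>\<Omega>. a \<le> X z}" using A by blast
    then have "A \<in> orthants \<Omega> C"
      unfolding orthants_def by (intro CollectI exI[of _ "{(X, a)}"]) auto
    then show ?thesis by (rule sigma_sets.Basic)
  qed
  show "A \<in> sigma_sets \<Omega> ?H" if A: "A \<in> orthants \<Omega> C" for A
  proof -
    obtain F where F: "finite F" "F \<subseteq> C \<times> UNIV" "A = {z\<in>\<Omega>. \<forall>(X, a)\<in>F. a \<le> X z}"
      using A unfolding orthants_def by blast
    have "{z\<in>\<Omega>. \<forall>p\<in>F. snd p \<le> fst p z} \<in> sigma_sets \<Omega> ?H"
    proof (rule sets_Collect_finite_All[OF _ F(1)])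
      fix p assume "p \<in> F"
      then have "fst p \<in> C" using F(2) by (cases p) auto
      then show "{z\<in>\<Omega>. snd p \<le> fst p z} \<in> sigma_sets \<Omega> ?H" by (blast intro: sigma_sets.Basic)
    qed
    then show ?thesis unfolding F(3) by (simp add: case_prod_beta)
  qed
qed

definition L2_approx :: "'a measure \<Rightarrow> ('a \<Rightarrow> real) set \<Rightarrow> ('a \<Rightarrow> real) \<Rightarrow> bool" where
  "L2_approx M N h \<longleftrightarrow> h \<in> borel_measurable M \<and>
     (\<forall>e>0. \<exists>f\<in>N. (\<integral>\<^sup>+z. ennreal ((h z - f z)\<^sup>2) \<partial>M) \<le> ennreal e)"

lemma L2_approxD:
  assumes "L2_approx M N h" "e > 0"
  obtains f where "f \<in> N" "(\<integral>\<^sup>+z. ennreal ((h z - f z)\<^sup>2) \<partial>M) \<le> ennreal e"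
  using assms unfolding L2_approx_def by blast

lemma nn_integral_sq_triangle:
  fixes f g h :: "'a \<Rightarrow> real"
  assumes [measurable]: "f \<in> borel_measurable M" "g \<in> borel_measurable M" "h \<in> borel_measurable M"
    and "(\<integral>\<^sup>+z. ennreal ((h z - g z)\<^sup>2) \<partial>M) \<le> ennreal a"
    and "(\<integral>\<^sup>+z. ennreal ((g z - f z)\<^sup>2) \<partial>M) \<le> ennreal b" and "a \<ge> 0" "b \<ge> 0"
  shows "(\<integral>\<^sup>+z. ennreal ((h z - f z)\<^sup>2) \<partial>M) \<le> ennreal (2 * a + 2 * b)"
proof -
  have *: "(x + y)\<^sup>2 \<le> 2 * x\<^sup>2 + 2 * y\<^sup>2" for x y :: real
    using sum_squares_bound[of x y] by (simp add: power2_sum)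
  have **: "ennreal (2 * x + 2 * y) = 2 * ennreal x + 2 * ennreal y" if "x \<ge> 0" "y \<ge> 0" for x y
    using that by (simp add: ennreal_mult')
  have "(\<integral>\<^sup>+z. ennreal ((h z - f z)\<^sup>2) \<partial>M)
      \<le> (\<integral>\<^sup>+z. 2 * ennreal ((h z - g z)\<^sup>2) + 2 * ennreal ((g z - f z)\<^sup>2) \<partial>M)"
  proof (rule nn_integral_mono)
    fix z
    have sq: "(h z - f z)\<^sup>2 \<le> 2 * (h z - g z)\<^sup>2 + 2 * (g z - f z)\<^sup>2"
      using *[of "h z - g z" "g z - f z"] by simp
    show "ennreal ((h z - f z)\<^sup>2) \<le> 2 * ennreal ((h z - g z)\<^sup>2) + 2 * ennreal ((g z - f z)\<^sup>2)"
      using ennreal_leI[OF sq] by (simp only: ** zero_le_power2)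
  qed
  also have "\<dots> = 2 * (\<integral>\<^sup>+z. ennreal ((h z - g z)\<^sup>2) \<partial>M) + 2 * (\<integral>\<^sup>+z. ennreal ((g z - f z)\<^sup>2) \<partial>M)"
    by (simp add: nn_integral_add nn_integral_cmult)
  also have "\<dots> \<le> 2 * ennreal a + 2 * ennreal b"
    by (intro add_mono mult_left_mono assms) auto
  also have "\<dots> = ennreal (2 * a + 2 * b)"
    using assms(6,7) by (simp only: **)
  finally show ?thesis .
qed

lemma L2_approx_closed:
  assumes "\<And>n. L2_approx M N (g n)" and N: "N \<subseteq> borel_measurable M" and h: "h \<in> borel_measurable M"
    and lim: "(\<lambda>n. \<integral>\<^sup>+z. ennreal ((h z - g n z)\<^sup>2) \<partial>M) \<longlonglongrightarrow> 0"
  shows "L2_approx M N h"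
  unfolding L2_approx_def
proof (intro conjI h allI impI)
  fix e :: real assume e: "e > 0"
  then have "\<forall>\<^sub>F n in sequentially. (\<integral>\<^sup>+z. ennreal ((h z - g n z)\<^sup>2) \<partial>M) < ennreal (e / 4)"
    by (intro order_tendstoD(2)[OF lim]) simp
  then obtain n where n: "(\<integral>\<^sup>+z. ennreal ((h z - g n z)\<^sup>2) \<partial>M) \<le> ennreal (e / 4)"
    using eventually_happens'[OF sequentially_bot] less_imp_le by blast
  obtain f where f: "f \<in> N" "(\<integral>\<^sup>+z. ennreal ((g n z - f z)\<^sup>2) \<partial>M) \<le> ennreal (e / 4)"
    using L2_approxD[OF assms(1)[of n], of "e / 4"] e by auto
  have "(\<integral>\<^sup>+z. ennreal ((h z - f z)\<^sup>2) \<partial>M) \<le> ennreal (2 * (e / 4) + 2 * (e / 4))"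
    using assms(1)[of n] f(1) N e by (intro nn_integral_sq_triangle[OF _ _ h n f(2)])
      (auto simp: L2_approx_def)
  then show "\<exists>f\<in>N. (\<integral>\<^sup>+z. ennreal ((h z - f z)\<^sup>2) \<partial>M) \<le> ennreal e" using f(1) by auto
qed

lemma L2_approx_dominated:
  assumes "\<And>n. L2_approx M N (g n)" and N: "N \<subseteq> borel_measurable M" and h: "h \<in> borel_measurable M"
    and w: "w \<in> borel_measurable M" "(\<integral>\<^sup>+z. ennreal ((w z)\<^sup>2) \<partial>M) < \<infinity>"
    and bound: "\<And>n z. z \<in> space M \<Longrightarrow> \<bar>h z - g n z\<bar> \<le> w z"
    and lim: "\<And>z. z \<in> space M \<Longrightarrow> (\<lambda>n. g n z) \<longlonglongrightarrow> h z"
  shows "L2_approx M N h"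
proof (rule L2_approx_closed[OF assms(1) N h])
  have [measurable]: "g n \<in> borel_measurable M" for n using assms(1) by (simp add: L2_approx_def)
  note [measurable] = h w(1)
  have "(\<lambda>n. \<integral>\<^sup>+z. ennreal ((h z - g n z)\<^sup>2) \<partial>M) \<longlonglongrightarrow> (\<integral>\<^sup>+z. 0 \<partial>M)"
  proof (rule nn_integral_dominated_convergence[where w="\<lambda>z. ennreal ((w z)\<^sup>2)"])
    show "AE z in M. ennreal ((h z - g n z)\<^sup>2) \<le> ennreal ((w z)\<^sup>2)" for n
    proof (rule AE_I2, rule ennreal_leI)
      fix z assume "z \<in> space M"
      from bound[OF this, of n] show "(h z - g n z)\<^sup>2 \<le> (w z)\<^sup>2"
        by (metis abs_ge_zero abs_le_square_iff abs_of_nonneg order_trans)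
    qed
    show "AE z in M. (\<lambda>n. ennreal ((h z - g n z)\<^sup>2)) \<longlonglongrightarrow> 0"
    proof (rule AE_I2)
      fix z assume "z \<in> space M"
      from lim[OF this] have "(\<lambda>n. (h z - g n z)\<^sup>2) \<longlonglongrightarrow> (h z - h z)\<^sup>2"
        by (intro tendsto_intros)
      then have "(\<lambda>n. ennreal ((h z - g n z)\<^sup>2)) \<longlonglongrightarrow> ennreal 0"
        by (intro tendsto_ennrealI) simp
      then show "(\<lambda>n. ennreal ((h z - g n z)\<^sup>2)) \<longlonglongrightarrow> 0" by simp
    qed
  qed (use w(2) in auto)
  then show "(\<lambda>n. \<integral>\<^sup>+z. ennreal ((h z - g n z)\<^sup>2) \<partial>M) \<longlonglongrightarrow> 0" by simp
qed

lemma (in finite_measure) nn_integral_const_sq_finite: "(\<integral>\<^sup>+z. ennreal (c\<^sup>2) \<partial>M) < \<infinity>"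
  using emeasure_finite[of "space M"] by (simp add: less_top[symmetric] ennreal_mult_eq_top_iff)

lemma L2_approx_add:
  assumes f: "L2_approx M N f" and g: "L2_approx M N g" and N: "N \<subseteq> borel_measurable M"
    and cl: "\<And>f g. f \<in> N \<Longrightarrow> g \<in> N \<Longrightarrow> (\<lambda>z. f z + g z) \<in> N"
  shows "L2_approx M N (\<lambda>z. f z + g z)"
  unfolding L2_approx_def
proof (intro conjI allI impI)
  have [measurable]: "f \<in> borel_measurable M" "g \<in> borel_measurable M"
    using f g by (auto simp: L2_approx_def)
  show "(\<lambda>z. f z + g z) \<in> borel_measurable M" by simp
  fix e :: real assume e: "e > 0"
  obtain f' where f': "f' \<in> N" "(\<integral>\<^sup>+z. ennreal ((f z - f' z)\<^sup>2) \<partial>M) \<le> ennreal (e / 4)"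
    using L2_approxD[OF f, of "e / 4"] e by auto
  obtain g' where g': "g' \<in> N" "(\<integral>\<^sup>+z. ennreal ((g z - g' z)\<^sup>2) \<partial>M) \<le> ennreal (e / 4)"
    using L2_approxD[OF g, of "e / 4"] e by auto
  have [measurable]: "f' \<in> borel_measurable M" "g' \<in> borel_measurable M" using f' g' N by auto
  have "(\<integral>\<^sup>+z. ennreal ((f z + g z - (f' z + g' z))\<^sup>2) \<partial>M) \<le> ennreal (2 * (e / 4) + 2 * (e / 4))"
    using f'(2) g'(2) e
    by (intro nn_integral_sq_triangle[where g="\<lambda>z. f' z + g z"]) (auto simp: algebra_simps)
  then show "\<exists>k\<in>N. (\<integral>\<^sup>+z. ennreal ((f z + g z - k z)\<^sup>2) \<partial>M) \<le> ennreal e"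
    using cl[OF f'(1) g'(1)] by (intro bexI[of _ "\<lambda>z. f' z + g' z"]) auto
qed

lemma L2_approx_scale:
  assumes f: "L2_approx M N f" and N: "N \<subseteq> borel_measurable M"
    and cl: "\<And>f c. f \<in> N \<Longrightarrow> (\<lambda>z. c * f z) \<in> N"
  shows "L2_approx M N (\<lambda>z. c * f z)"
  unfolding L2_approx_def
proof (intro conjI allI impI)
  have [measurable]: "f \<in> borel_measurable M" using f by (auto simp: L2_approx_def)
  show "(\<lambda>z. c * f z) \<in> borel_measurable M" by simp
  fix e :: real assume e: "e > 0"
  define d where "d = e / (c\<^sup>2 + 1)"
  have c: "c\<^sup>2 + 1 > 0" using zero_le_power2[of c] by linarith
  have d: "d > 0" "c\<^sup>2 * d \<le> e"
    using e c by (auto simp: d_def field_simps)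
  obtain f' where f': "f' \<in> N" "(\<integral>\<^sup>+z. ennreal ((f z - f' z)\<^sup>2) \<partial>M) \<le> ennreal d"
    using f d unfolding L2_approx_def by blast
  have [measurable]: "f' \<in> borel_measurable M" using f' N by auto
  have "(\<integral>\<^sup>+z. ennreal ((c * f z - c * f' z)\<^sup>2) \<partial>M) = (\<integral>\<^sup>+z. ennreal (c\<^sup>2) * ennreal ((f z - f' z)\<^sup>2) \<partial>M)"
    by (simp add: power_mult_distrib flip: ennreal_mult right_diff_distrib)
  also have "\<dots> = ennreal (c\<^sup>2) * (\<integral>\<^sup>+z. ennreal ((f z - f' z)\<^sup>2) \<partial>M)"
    by (rule nn_integral_cmult) simp
  also have "\<dots> \<le> ennreal (c\<^sup>2) * ennreal d" by (intro mult_left_mono f') auto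
  also have "\<dots> \<le> ennreal e" using d by (simp add: ennreal_leI flip: ennreal_mult)
  finally show "\<exists>k\<in>N. (\<integral>\<^sup>+z. ennreal ((c * f z - k z)\<^sup>2) \<partial>M) \<le> ennreal e"
    using cl[OF f'(1)] by (intro bexI[of _ "\<lambda>z. c * f' z"]) auto
qed

lemma L2_approx_mem: "f \<in> N \<Longrightarrow> N \<subseteq> borel_measurable M \<Longrightarrow> L2_approx M N f"
  unfolding L2_approx_def by (auto intro!: bexI[of _ f])

text \<open>The \<open>\<sigma>\<close>-algebra generated by the inputs decides what can be approximated. The functions approximable in \<open>L\<^sup>2\<close>
  form a vector space closed under dominated limits, which contains the indicators of orthants; these are stable under
  intersection and generate, so Dynkin's theorem yields all indicators.\<close>

lemma net_dense_L2:
  fixes C :: "('a \<Rightarrow> real) set"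
  assumes "finite_measure M" and s: "squashing s"
    and gen: "sets M = sigma_sets (space M) {{z\<in>space M. a \<le> X z} | X a. X \<in> C}"
    and h: "h \<in> borel_measurable M" "(\<integral>\<^sup>+z. ennreal ((h z)\<^sup>2) \<partial>M) < \<infinity>"
  shows "L2_approx M (net s C) h"
proof -
  interpret finite_measure M by fact
  define N where "N = net s C"
  have C: "C \<subseteq> borel_measurable M"
  proof
    fix X assume X: "X \<in> C"
    show "X \<in> borel_measurable M"
      unfolding borel_measurable_iff_ge gen using X by (blast intro: sigma_sets.Basic)
  qed
  have N: "N \<subseteq> borel_measurable M"
    using net_measurable[OF s _ C] unfolding N_def by blast
  have N_add: "(\<lambda>z. f z + g z) \<in> N" if "f \<in> N" "g \<in> N" for f g
    using that unfolding N_def net_def by (rule affine_span.add)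
  have N_scale: "(\<lambda>z. c * f z) \<in> N" if "f \<in> N" for f c
    using that unfolding N_def net_def by (rule affine_span.scale)
  have N_const: "(\<lambda>_. c) \<in> N" for c unfolding N_def net_def by (rule affine_span.const)
  note K_add = L2_approx_add[OF _ _ N N_add] and K_scale = L2_approx_scale[OF _ N N_scale]
    and K_const = L2_approx_mem[OF N_const N]
  have K_sum: "L2_approx M N (\<lambda>z. \<Sum>i\<in>I. f i z)" if "\<And>i. i \<in> I \<Longrightarrow> L2_approx M N (f i)" 
    for I :: "'i set" and f
    using that by (induction I rule: infinite_finite_induct) (auto intro: K_add K_const)
  define G where "G = orthants (space M) C"
  have gen_G: "sets M = sigma_sets (space M) G" unfolding G_def gen by (rule sigma_sets_orthants)
  then have G_sets: "G \<subseteq> sets M" by (auto intro: sigma_sets.Basic)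
  have ind: "L2_approx M N (indicator A)" if "A \<in> sets M" for A
  proof (rule sigma_sets_induct_disjoint[of G "space M" A])
    show "Int_stable G" unfolding G_def by (rule Int_stable_orthants)
    show "G \<subseteq> Pow (space M)" using G_sets sets.sets_into_space by blast
    show "A \<in> sigma_sets (space M) G" using that gen_G by simp
  next
    fix A assume A: "A \<in> G"
    then obtain F where F: "finite F" "F \<subseteq> C \<times> UNIV" "A = {z\<in>space M. \<forall>(X, a)\<in>F. a \<le> X z}"
      unfolding G_def orthants_def by blast
    obtain f where f: "\<And>n. f n \<in> net s C" "\<And>n z. \<bar>f n z\<bar> \<le> 1"
      "\<And>z. (\<lambda>n. f n z) \<longlonglongrightarrow> (if \<forall>(X, a)\<in>F. a \<le> X z then 1 else 0)"
      using orthant_net_limit[OF s F(1,2)] by blast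
    show "L2_approx M N (indicator A)"
    proof (rule L2_approx_dominated[where g=f and w="\<lambda>_. 2"])
      show "L2_approx M N (f n)" for n using f(1) N by (intro L2_approx_mem) (auto simp: N_def)
      have "A \<in> sets M" using G_sets A by blast
      then show "(indicator A :: _ \<Rightarrow> real) \<in> borel_measurable M" by simp
      show "\<bar>indicator A z - f n z\<bar> \<le> 2" for n z
        using f(2)[of n z] by (auto simp: indicator_def)
      show "(\<lambda>n. f n z) \<longlonglongrightarrow> indicator A z" if "z \<in> space M" for z
      proof -
        have "indicator A z = (if \<forall>(X, a)\<in>F. a \<le> X z then 1 else 0 :: real)"
          using that by (auto simp: F(3) indicator_def)
        then show ?thesis using f(3)[of z] by (simp only:)
      qed
    qed (use N nn_integral_const_sq_finite[of 2] in auto)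
  next
    have "(indicator {} :: 'a \<Rightarrow> real) = (\<lambda>_. 0)" by (rule ext) simp
    then show "L2_approx M N (indicator {})" using K_const[of 0] by (simp only:)
  next
    fix A assume A: "A \<in> sigma_sets (space M) G" "L2_approx M N (indicator A)"
    then have A': "A \<in> sets M" by (simp add: gen_G)
    show "L2_approx M N (indicator (space M - A))"
    proof (rule L2_approx_dominated[where g="\<lambda>_ z. 1 + (-1) * indicator A z" and w="\<lambda>_. 0"])
      show "L2_approx M N (\<lambda>z. 1 + (-1) * indicator A z)" by (intro K_add K_scale K_const A(2))
    qed (use N A' in \<open>auto simp: indicator_def\<close>)
  next
    fix A :: "nat \<Rightarrow> 'a set"
    assume A: "disjoint_family A" "range A \<subseteq> sigma_sets (space M) G" "\<And>i. L2_approx M N (indicator (A i))"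
    then have A': "A i \<in> sets M" for i using gen_G by auto
    have sum: "(\<Sum>i<n. indicator (A i) z) = (indicator (\<Union>i<n. A i) z :: real)" for n z
      using A(1) by (intro indicator_UN_disjoint[symmetric])
        (auto simp: disjoint_family_on_def)
    show "L2_approx M N (indicator (\<Union>i. A i))"
    proof (rule L2_approx_dominated[where g="\<lambda>n z. \<Sum>i<n. indicator (A i) z" and w="\<lambda>_. 1"])
      show "L2_approx M N (\<lambda>z. \<Sum>i<n. indicator (A i) z)" for n by (intro K_sum A(3))
      show "\<bar>indicator (\<Union>i. A i) z - (\<Sum>i<n. indicator (A i) z)\<bar> \<le> (1::real)" for n z
        unfolding sum by (auto simp: indicator_def)
      show "(\<lambda>n. \<Sum>i<n. indicator (A i) z) \<longlonglongrightarrow> (indicator (\<Union>i. A i) z :: real)" for z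
        unfolding sum by (rule LIMSEQ_indicator_UN)
    qed (use N A' nn_integral_const_sq_finite[of 1] in auto)
  qed
  obtain F where F: "\<And>i. simple_function M (F i)" "\<And>z. z \<in> space M \<Longrightarrow> (\<lambda>i. F i z) \<longlonglongrightarrow> h z"
    "\<And>i z. z \<in> space M \<Longrightarrow> \<bar>F i z\<bar> \<le> 2 * \<bar>h z\<bar>"
    using borel_measurable_implies_sequence_metric[OF h(1), of 0]
    unfolding dist_real_def diff_0_right by blast
  have F_approx: "L2_approx M N (\<lambda>z. \<Sum>y\<in>F i ` space M. y * indicator (F i -` {y} \<inter> space M) z)" for i
    by (intro K_sum K_scale ind simple_functionD(2)[OF F(1)])
  have F_eq: "(\<Sum>y\<in>F i ` space M. y * indicator (F i -` {y} \<inter> space M) z) = F i z" 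
    if "z \<in> space M" for i z
  proof -
    have "(\<Sum>y\<in>F i ` space M. y * indicator (F i -` {y} \<inter> space M) z) =
        (\<Sum>y\<in>F i ` space M. indicator (F i -` {y} \<inter> space M) z *\<^sub>R y)"
      by (intro sum.cong) auto
    also have "\<dots> = F i z"
      by (rule simple_function_indicator_representation_banach[OF F(1) that, symmetric])
    finally show ?thesis .
  qed
  show ?thesis unfolding N_def[symmetric]
  proof (rule L2_approx_dominated[where w="\<lambda>z. 3 * \<bar>h z\<bar>", OF F_approx N h(1)])
    have "(\<integral>\<^sup>+z. ennreal ((3 * \<bar>h z\<bar>)\<^sup>2) \<partial>M) = (\<integral>\<^sup>+z. 9 * ennreal ((h z)\<^sup>2) \<partial>M)"
      using ennreal_mult[of 9 "(h z)\<^sup>2" for z] by (simp add: power_mult_distrib)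
    also have "\<dots> = 9 * (\<integral>\<^sup>+z. ennreal ((h z)\<^sup>2) \<partial>M)" using h(1) by (intro nn_integral_cmult) simp
    also have "\<dots> < \<infinity>" using h(2) by (simp add: ennreal_mult_less_top)
    finally show "(\<integral>\<^sup>+z. ennreal ((3 * \<bar>h z\<bar>)\<^sup>2) \<partial>M) < \<infinity>" .
    show "\<bar>h z - (\<Sum>y\<in>F i ` space M. y * indicator (F i -` {y} \<inter> space M) z)\<bar> \<le> 3 * \<bar>h z\<bar>"
      if "z \<in> space M" for i z
      using F(3)[OF that, of i] by (simp add: F_eq that)
    show "(\<lambda>i. \<Sum>y\<in>F i ` space M. y * indicator (F i -` {y} \<inter> space M) z) \<longlonglongrightarrow> h z"
      if "z \<in> space M" for z
      using F(2)[OF that] by (simp add: F_eq that)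
  qed (use h(1) in simp)
qed

section \<open>Couplings and continuity for the Wasserstein distance\<close>

lemma topspace_P2_topology: "topspace P2_topology = P2"
proof -
  have "openin P2_topology P2" unfolding openin_P2_topology by (auto intro: exI[of _ 1])
  moreover have "topspace P2_topology \<subseteq> P2" using openin_P2_topology openin_topspace by blast
  ultimately show ?thesis using openin_subset by blast
qed

lemma P2_D:
  assumes "\<mu> \<in> P2"
  shows "prob_space \<mu>" "sets \<mu> = sets borel" "space \<mu> = UNIV"
    "(\<integral>\<^sup>+x. ennreal ((norm x)\<^sup>2) \<partial>\<mu>) < \<infinity>"
  using assms sets_eq_imp_space_eq[of \<mu> borel] by (auto simp: P2_def)

lemma coupling_nn_integral:
  fixes \<mu> \<mu>' :: "'a::euclidean_space measure"
  assumes "\<pi> \<in> couplings \<mu> \<mu>'" "f \<in> borel_measurable borel"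
  shows "(\<integral>\<^sup>+z. f (fst z) \<partial>\<pi>) = (\<integral>\<^sup>+x. f x \<partial>\<mu>)" "(\<integral>\<^sup>+z. f (snd z) \<partial>\<pi>) = (\<integral>\<^sup>+x. f x \<partial>\<mu>')"
proof -
  have s: "sets \<pi> = sets (borel \<Otimes>\<^sub>M borel)" using assms(1) unfolding couplings_def borel_prod by simp
  have m: "fst \<in> measurable \<pi> borel" "snd \<in> measurable \<pi> borel"
    by (simp_all add: measurable_cong_sets[OF s refl])
  have d: "distr \<pi> borel fst = \<mu>" "distr \<pi> borel snd = \<mu>'" using assms(1) by (auto simp: couplings_def)
  show "(\<integral>\<^sup>+z. f (fst z) \<partial>\<pi>) = (\<integral>\<^sup>+x. f x \<partial>\<mu>)"
    unfolding d(1)[symmetric] using m(1) assms(2) by (simp add: nn_integral_distr)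
  show "(\<integral>\<^sup>+z. f (snd z) \<partial>\<pi>) = (\<integral>\<^sup>+x. f x \<partial>\<mu>')"
    unfolding d(2)[symmetric] using m(2) assms(2) by (simp add: nn_integral_distr)
qed

text \<open>The only source of upper bounds on \<open>W2\<close>: transport plans are given as images of a measure under a pair of maps, so
  that marginals and cost need no computation.\<close>

lemma coupling_distr:
  fixes g h :: "'b \<Rightarrow> 'a::euclidean_space"
  assumes [measurable]: "g \<in> borel_measurable N" "h \<in> borel_measurable N"
  shows "distr N borel (\<lambda>z. (g z, h z)) \<in> couplings (distr N borel g) (distr N borel h)"
    and "(\<integral>\<^sup>+z. ennreal ((norm (fst z - snd z))\<^sup>2) \<partial>distr N borel (\<lambda>z. (g z, h z))) =
      (\<integral>\<^sup>+z. ennreal ((norm (g z - h z))\<^sup>2) \<partial>N)"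
proof -
  have "(\<lambda>z. (g z, h z)) \<in> measurable N (borel \<Otimes>\<^sub>M borel)" by measurable
  then have [measurable]: "(\<lambda>z. (g z, h z)) \<in> measurable N borel" by (simp only: borel_prod)
  have [measurable]: "fst \<in> borel_measurable (borel :: ('a \<times> 'a) measure)"
    "snd \<in> borel_measurable (borel :: ('a \<times> 'a) measure)"
    by (simp_all add: borel_measurable_continuous_onI continuous_on_fst continuous_on_snd continuous_on_id)
  show "distr N borel (\<lambda>z. (g z, h z)) \<in> couplings (distr N borel g) (distr N borel h)"
    by (simp add: couplings_def distr_distr o_def)
  show "(\<integral>\<^sup>+z. ennreal ((norm (fst z - snd z))\<^sup>2) \<partial>distr N borel (\<lambda>z. (g z, h z))) =
      (\<integral>\<^sup>+z. ennreal ((norm (g z - h z))\<^sup>2) \<partial>N)"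
    by (simp add: nn_integral_distr)
qed

lemma W2_distr_tendsto:
  fixes g h :: "nat \<Rightarrow> 'b \<Rightarrow> 'a::euclidean_space"
  assumes m: "\<And>n. g n \<in> borel_measurable (N n)" "\<And>n. h n \<in> borel_measurable (N n)"
    and lim: "(\<lambda>n. \<integral>\<^sup>+z. ennreal ((norm (g n z - h n z))\<^sup>2) \<partial>N n) \<longlonglongrightarrow> 0"
  shows "(\<lambda>n. W2 (distr (N n) borel (g n)) (distr (N n) borel (h n))) \<longlonglongrightarrow> 0"
proof -
  define c where "c n = (\<integral>\<^sup>+z. ennreal ((norm (g n z - h n z))\<^sup>2) \<partial>N n)" for n
  have c: "c \<longlonglongrightarrow> 0" using lim unfolding c_def .
  have "\<forall>\<^sub>F n in sequentially. c n < 1" by (rule order_tendstoD(2)[OF c]) simp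
  then have le: "\<forall>\<^sub>F n in sequentially.
      W2 (distr (N n) borel (g n)) (distr (N n) borel (h n)) \<le> sqrt (enn2real (c n))"
  proof eventually_elim
    case (elim n)
    have "(INF \<pi>\<in>couplings (distr (N n) borel (g n)) (distr (N n) borel (h n)).
        \<integral>\<^sup>+z. ennreal ((norm (fst z - snd z))\<^sup>2) \<partial>\<pi>) \<le> c n"
      unfolding c_def by (rule INF_lower2[OF coupling_distr(1)[OF m]]) (simp add: coupling_distr(2)[OF m])
    then show ?case unfolding W2_def
      using elim by (intro real_sqrt_le_mono enn2real_mono) (auto intro: less_trans)
  qed
  have "(\<lambda>n. sqrt (enn2real (c n))) \<longlonglongrightarrow> sqrt (enn2real 0)"
    using c by (intro tendsto_real_sqrt tendsto_enn2real) auto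
  then show ?thesis
    by (intro tendsto_sandwich[OF _ le tendsto_const, of 0]) (auto simp: W2_def)
qed

text \<open>A small value of \<open>W2\<close> yields a cheap coupling only after the infimum is known to be finite, because the conversion
  to a real number sends infinity to zero. The product coupling has finite cost by the second moments.\<close>

lemma W2_less_coupling:
  fixes \<mu> \<mu>' :: "'a::euclidean_space measure"
  assumes "\<mu> \<in> P2" "\<mu>' \<in> P2" "W2 \<mu> \<mu>' < r"
  obtains \<pi> where "\<pi> \<in> couplings \<mu> \<mu>'"
    "(\<integral>\<^sup>+z. ennreal ((norm (fst z - snd z))\<^sup>2) \<partial>\<pi>) \<le> ennreal (r\<^sup>2)"
proof -
  interpret \<mu>: prob_space \<mu> using P2_D(1)[OF assms(1)] .
  interpret \<mu>': prob_space \<mu>' using P2_D(1)[OF assms(2)] .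
  interpret pair_prob_space \<mu> \<mu>' ..
  let ?cost = "\<lambda>\<pi> :: ('a \<times> 'a) measure. \<integral>\<^sup>+z. ennreal ((norm (fst z - snd z))\<^sup>2) \<partial>\<pi>"
  let ?\<pi> = "\<mu> \<Otimes>\<^sub>M \<mu>'"
  note [measurable_cong] = P2_D(2)[OF assms(1)] P2_D(2)[OF assms(2)]
  have sp: "sets ?\<pi> = sets (borel \<Otimes>\<^sub>M borel)"
    using P2_D(2)[OF assms(1)] P2_D(2)[OF assms(2)] by (rule sets_pair_measure_cong)
  have \<pi>: "?\<pi> \<in> couplings \<mu> \<mu>'"
    unfolding couplings_def
  proof (intro CollectI conjI)
    show "sets ?\<pi> = sets borel" using sp unfolding borel_prod .
    show "distr ?\<pi> borel fst = \<mu>"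
    proof (rule measure_eqI)
      fix A assume "A \<in> sets (distr ?\<pi> borel fst)"
      then have A: "A \<in> sets borel" by simp
      have "emeasure (distr ?\<pi> borel fst) A = emeasure ?\<pi> (A \<times> UNIV)"
        using A by (subst emeasure_distr) (auto intro!: arg_cong2[where f=emeasure]
            simp: space_pair_measure P2_D(3)[OF assms(1)] P2_D(3)[OF assms(2)])
      also have "\<dots> = emeasure \<mu> A * emeasure \<mu>' UNIV"
        using A P2_D(2)[OF assms(1)] P2_D(2)[OF assms(2)]
        by (intro \<mu>'.emeasure_pair_measure_Times) auto
      also have "\<dots> = emeasure \<mu> A" using \<mu>'.emeasure_space_1 P2_D(3)[OF assms(2)] by simp
      finally show "emeasure (distr ?\<pi> borel fst) A = emeasure \<mu> A" .
    qed (simp add: P2_D(2)[OF assms(1)])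
    show "distr ?\<pi> borel snd = \<mu>'"
    proof (rule measure_eqI)
      fix A assume "A \<in> sets (distr ?\<pi> borel snd)"
      then have A: "A \<in> sets borel" by simp
      have "emeasure (distr ?\<pi> borel snd) A = emeasure ?\<pi> (UNIV \<times> A)"
        using A by (subst emeasure_distr) (auto intro!: arg_cong2[where f=emeasure]
            simp: space_pair_measure P2_D(3)[OF assms(1)] P2_D(3)[OF assms(2)])
      also have "\<dots> = emeasure \<mu> UNIV * emeasure \<mu>' A"
        using A P2_D(2)[OF assms(1)] P2_D(2)[OF assms(2)]
        by (intro \<mu>'.emeasure_pair_measure_Times) auto
      also have "\<dots> = emeasure \<mu>' A" using \<mu>.emeasure_space_1 P2_D(3)[OF assms(1)] by simp
      finally show "emeasure (distr ?\<pi> borel snd) A = emeasure \<mu>' A" .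
    qed (simp add: P2_D(2)[OF assms(2)])
  qed
  have two: "ennreal (2 * x + 2 * y) = 2 * ennreal x + 2 * ennreal y" if "x \<ge> 0" "y \<ge> 0" for x y
    using that by (simp add: ennreal_mult')
  have "?cost ?\<pi> \<le> (\<integral>\<^sup>+z. 2 * ennreal ((norm (fst z))\<^sup>2) + 2 * ennreal ((norm (snd z))\<^sup>2) \<partial>?\<pi>)"
  proof (rule nn_integral_mono)
    fix z :: "'a \<times> 'a"
    have "(norm (fst z - snd z))\<^sup>2 \<le> (norm (fst z) + norm (snd z))\<^sup>2"
      by (intro power_mono norm_triangle_ineq4) auto
    also have "\<dots> \<le> 2 * (norm (fst z))\<^sup>2 + 2 * (norm (snd z))\<^sup>2"
      using sum_squares_bound[of "norm (fst z)" "norm (snd z)"] by (simp add: power2_sum)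
    finally show "ennreal ((norm (fst z - snd z))\<^sup>2)
        \<le> 2 * ennreal ((norm (fst z))\<^sup>2) + 2 * ennreal ((norm (snd z))\<^sup>2)"
      using ennreal_leI by (simp only: two[symmetric] zero_le_power2)
  qed
  also have "\<dots> = 2 * (\<integral>\<^sup>+z. ennreal ((norm (fst z))\<^sup>2) \<partial>?\<pi>) + 2 * (\<integral>\<^sup>+z. ennreal ((norm (snd z))\<^sup>2) \<partial>?\<pi>)"
    by (simp add: nn_integral_add nn_integral_cmult)
  also have "\<dots> = 2 * (\<integral>\<^sup>+x. ennreal ((norm x)\<^sup>2) \<partial>\<mu>) + 2 * (\<integral>\<^sup>+x. ennreal ((norm x)\<^sup>2) \<partial>\<mu>')"
    using coupling_nn_integral[OF \<pi>, of "\<lambda>x. ennreal ((norm x)\<^sup>2)"] by simp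
  also have "\<dots> < \<infinity>"
    using P2_D(4)[OF assms(1)] P2_D(4)[OF assms(2)] by (simp add: ennreal_mult_less_top)
  finally have "?cost ?\<pi> < \<infinity>" .
  then have fin: "(INF \<pi>\<in>couplings \<mu> \<mu>'. ?cost \<pi>) < \<infinity>"
    using INF_lower[OF \<pi>, of ?cost] by (rule le_less_trans[rotated])
  define I where "I = (INF \<pi>\<in>couplings \<mu> \<mu>'. ?cost \<pi>)"
  have "(sqrt (enn2real I))\<^sup>2 < r\<^sup>2"
    using assms(3) unfolding W2_def I_def by (intro power_strict_mono) auto
  then have "ennreal (enn2real I) < ennreal (r\<^sup>2)" by (simp add: ennreal_less_iff)
  then have "(INF \<pi>\<in>couplings \<mu> \<mu>'. ?cost \<pi>) < ennreal (r\<^sup>2)"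
    using fin by (simp add: I_def)
  then obtain \<pi> where "\<pi> \<in> couplings \<mu> \<mu>'" "?cost \<pi> < ennreal (r\<^sup>2)"
    unfolding INF_less_iff by blast
  then show thesis using that by (blast intro: less_imp_le)
qed

text \<open>Under a coupling the difference of the integrals is the mean of \<open>f (fst z) - f (snd z)\<close>, whose square is at most
  the mean of the square, hence at most \<open>L\<^sup>2\<close> times the transport cost.\<close>

lemma integral_lipschitz_coupling:
  fixes f :: "'a::euclidean_space \<Rightarrow> real"
  assumes L: "L-lipschitz_on UNIV f" and B: "\<And>x. \<bar>f x\<bar> \<le> B"
    and P: "\<mu> \<in> P2" "\<mu>' \<in> P2" and \<pi>: "\<pi> \<in> couplings \<mu> \<mu>'" and r: "r \<ge> 0"
    and cost: "(\<integral>\<^sup>+z. ennreal ((norm (fst z - snd z))\<^sup>2) \<partial>\<pi>) \<le> ennreal (r\<^sup>2)"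
  shows "\<bar>(\<integral>x. f x \<partial>\<mu>) - (\<integral>x. f x \<partial>\<mu>')\<bar> \<le> L * r"
proof -
  have [measurable]: "f \<in> borel_measurable borel"
    using L by (intro borel_measurable_continuous_onI lipschitz_on_continuous_on)
  have s[measurable_cong]: "sets \<pi> = sets (borel \<Otimes>\<^sub>M borel)" using \<pi> unfolding couplings_def borel_prod by simp
  have d: "distr \<pi> borel fst = \<mu>" "distr \<pi> borel snd = \<mu>'" using \<pi> by (auto simp: couplings_def)
  interpret \<mu>: prob_space \<mu> using P2_D(1)[OF P(1)] .
  interpret \<pi>: prob_space \<pi>
  proof
    have "emeasure \<pi> (space \<pi>) = emeasure (distr \<pi> borel fst) UNIV"
      by (subst emeasure_distr) auto
    then show "emeasure \<pi> (space \<pi>) = 1" using \<mu>.emeasure_space_1 P2_D(3)[OF P(1)] by (simp add: d)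
  qed
  define g where "g z = f (fst z) - f (snd z)" for z
  have g[measurable]: "g \<in> borel_measurable \<pi>" unfolding g_def by measurable
  have int: "integrable \<pi> (\<lambda>z. f (fst z))" "integrable \<pi> (\<lambda>z. f (snd z))"
    using B by (auto intro!: \<pi>.integrable_const_bound[where B=B])
  have g_bd: "\<bar>g z\<bar> \<le> 2 * B" for z using B[of "fst z"] B[of "snd z"] by (simp add: g_def)
  have int_g: "integrable \<pi> g"
    by (rule \<pi>.integrable_const_bound[where B="2 * B"]) (use g_bd in auto)
  have int_g2: "integrable \<pi> (\<lambda>z. (g z)\<^sup>2)"
  proof (rule \<pi>.integrable_const_bound[where B="(2 * B)\<^sup>2"])
    show "AE z in \<pi>. norm ((g z)\<^sup>2) \<le> (2 * B)\<^sup>2"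
      using power_mono[OF g_bd abs_ge_zero, where n=2] by (intro AE_I2) simp
  qed simp
  have "(\<integral>x. f x \<partial>\<mu>) - (\<integral>x. f x \<partial>\<mu>') = (\<integral>z. f (fst z) \<partial>\<pi>) - (\<integral>z. f (snd z) \<partial>\<pi>)"
    unfolding d[symmetric] by (simp add: integral_distr)
  also have "\<dots> = (\<integral>z. g z \<partial>\<pi>)" unfolding g_def using int by simp
  finally have eq: "(\<integral>x. f x \<partial>\<mu>) - (\<integral>x. f x \<partial>\<mu>') = (\<integral>z. g z \<partial>\<pi>)" .
  have "(\<integral>z. g z \<partial>\<pi>)\<^sup>2 \<le> (\<integral>z. (g z)\<^sup>2 \<partial>\<pi>)"
    using \<pi>.variance_positive[of g] \<pi>.variance_eq[OF int_g int_g2] by simp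
  also have "\<dots> \<le> (L * r)\<^sup>2"
  proof -
    have "ennreal (\<integral>z. (g z)\<^sup>2 \<partial>\<pi>) = (\<integral>\<^sup>+z. ennreal ((g z)\<^sup>2) \<partial>\<pi>)"
      using int_g2 by (intro nn_integral_eq_integral[symmetric]) auto
    also have "\<dots> \<le> (\<integral>\<^sup>+z. ennreal (L\<^sup>2) * ennreal ((norm (fst z - snd z))\<^sup>2) \<partial>\<pi>)"
    proof (rule nn_integral_mono)
      fix z
      have "\<bar>g z\<bar> \<le> L * norm (fst z - snd z)"
        using lipschitz_onD[OF L, of "fst z" "snd z"] by (simp add: g_def dist_real_def dist_norm)
      then have "\<bar>g z\<bar>\<^sup>2 \<le> (L * norm (fst z - snd z))\<^sup>2" by (rule power_mono) simp
      then show "ennreal ((g z)\<^sup>2) \<le> ennreal (L\<^sup>2) * ennreal ((norm (fst z - snd z))\<^sup>2)"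
        by (simp add: power_mult_distrib ennreal_leI flip: ennreal_mult)
    qed
    also have "\<dots> = ennreal (L\<^sup>2) * (\<integral>\<^sup>+z. ennreal ((norm (fst z - snd z))\<^sup>2) \<partial>\<pi>)"
      by (rule nn_integral_cmult) simp
    also have "\<dots> \<le> ennreal (L\<^sup>2) * ennreal (r\<^sup>2)" by (intro mult_left_mono cost) simp
    also have "\<dots> = ennreal ((L * r)\<^sup>2)" by (simp add: power_mult_distrib ennreal_mult)
    finally show ?thesis by (simp add: ennreal_le_iff)
  qed
  finally have "\<bar>\<integral>z. g z \<partial>\<pi>\<bar> \<le> \<bar>L * r\<bar>" by (simp add: abs_le_square_iff)
  also have "\<dots> = L * r" using lipschitz_on_nonneg[OF L] r by simp
  finally show ?thesis by (simp add: eq)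
qed

lemma sets_P2_borel: "sets P2_borel = sigma_sets P2 {U. openin P2_topology U}"
  and space_P2_borel: "space P2_borel = P2"
proof -
  have *: "{U. openin P2_topology U} \<subseteq> Pow P2" using openin_P2_topology by blast
  show "sets P2_borel = sigma_sets P2 {U. openin P2_topology U}" "space P2_borel = P2"
    unfolding P2_borel_def by (rule sets_measure_of[OF *], rule space_measure_of[OF *])
qed

lemma integral_lipschitz_P2_borel:
  fixes f :: "'a::euclidean_space \<Rightarrow> real"
  assumes L: "L-lipschitz_on UNIV f" and B: "\<And>x. \<bar>f x\<bar> \<le> B"
  shows "(\<lambda>\<mu>. \<integral>x. f x \<partial>\<mu>) \<in> borel_measurable P2_borel"
  unfolding borel_measurable_iff_less
proof
  fix a :: real
  let ?U = "{\<mu>\<in>P2. (\<integral>x. f x \<partial>\<mu>) < a}"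
  have L0: "0 \<le> L" by (rule lipschitz_on_nonneg[OF L])
  have "openin P2_topology ?U"
    unfolding openin_P2_topology
  proof (intro conjI ballI)
    fix \<mu> assume \<mu>: "\<mu> \<in> ?U"
    define r where "r = (a - (\<integral>x. f x \<partial>\<mu>)) / (L + 1)"
    have r: "r > 0" "L * r < a - (\<integral>x. f x \<partial>\<mu>)"
      using \<mu> L0 by (auto simp: r_def field_simps)
    have "\<mu>' \<in> ?U" if \<mu>': "\<mu>' \<in> P2" "W2 \<mu> \<mu>' < r" for \<mu>'
    proof -
      obtain \<pi> where "\<pi> \<in> couplings \<mu> \<mu>'"
        "(\<integral>\<^sup>+z. ennreal ((norm (fst z - snd z))\<^sup>2) \<partial>\<pi>) \<le> ennreal (r\<^sup>2)"
        using W2_less_coupling[of \<mu> \<mu>' r] \<mu> \<mu>' by blast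
      then have "\<bar>(\<integral>x. f x \<partial>\<mu>) - (\<integral>x. f x \<partial>\<mu>')\<bar> \<le> L * r"
        using \<mu> \<mu>' r by (intro integral_lipschitz_coupling[OF L B, of \<mu> \<mu>' \<pi>]) auto
      then show ?thesis using r(2) \<mu>'(1) by auto
    qed
    then show "\<exists>r>0. \<forall>\<mu>'\<in>P2. W2 \<mu> \<mu>' < r \<longrightarrow> \<mu>' \<in> ?U" using r(1) by blast
  qed auto
  then show "{\<mu>\<in>space P2_borel. (\<integral>x. f x \<partial>\<mu>) < a} \<in> sets P2_borel"
    unfolding sets_P2_borel space_P2_borel by (intro sigma_sets.Basic) simp
qed

text \<open>An open set contains a ball around each of its points, so \<open>W2 \<mu> (\<rho> n) \<longlonglongrightarrow> 0\<close> brings \<open>\<rho> n\<close> into every open set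
  around \<open>\<mu>\<close>.\<close>

lemma continuous_map_P2_tendsto:
  fixes V :: "'a::euclidean_space \<times> 'a measure \<Rightarrow> 'b::metric_space"
  assumes V: "continuous_map (prod_topology euclidean P2_topology) euclidean V"
    and P: "\<mu> \<in> P2" "\<And>n::nat. \<rho> n \<in> P2" and lim: "(\<lambda>n. W2 \<mu> (\<rho> n)) \<longlonglongrightarrow> 0"
  shows "(\<lambda>n. V (x, \<rho> n)) \<longlonglongrightarrow> V (x, \<mu>)"
proof (rule topological_tendstoI)
  fix U assume U: "open U" "V (x, \<mu>) \<in> U"
  have "continuous_map P2_topology (prod_topology euclidean P2_topology) (\<lambda>\<rho>. (x, \<rho>))"
    by (intro continuous_map_pairedI) auto
  from continuous_map_compose[OF this V]
  have "continuous_map P2_topology euclidean (\<lambda>\<rho>. V (x, \<rho>))" by (simp add: o_def)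
  then have "openin P2_topology {\<rho> \<in> topspace P2_topology. V (x, \<rho>) \<in> U}"
    using U(1) by (intro openin_continuous_map_preimage) auto
  then obtain r where "r > 0" and r: "\<And>\<mu>'. \<mu>' \<in> P2 \<Longrightarrow> W2 \<mu> \<mu>' < r \<Longrightarrow> V (x, \<mu>') \<in> U"
    using P(1) U(2) unfolding openin_P2_topology topspace_P2_topology by blast
  from order_tendstoD(2)[OF lim \<open>r > 0\<close>] show "\<forall>\<^sub>F n in sequentially. V (x, \<rho> n) \<in> U"
    by (rule eventually_mono) (intro r P(2))
qed

lemma continuous_map_P2_section:
  fixes V :: "'a::euclidean_space \<times> 'a measure \<Rightarrow> 'b::metric_space"
  assumes V: "continuous_map (prod_topology euclidean P2_topology) euclidean V"
    and P: "\<mu> \<in> P2"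
  shows "(\<lambda>x. V (x, \<mu>)) \<in> borel_measurable borel"
proof -
  have "continuous_map euclidean (prod_topology euclidean P2_topology) (\<lambda>x. (x, \<mu>))"
    using P by (intro continuous_map_pairedI) (auto simp: topspace_P2_topology)
  from continuous_map_compose[OF this V] have "continuous_on UNIV (\<lambda>x. V (x, \<mu>))" by (simp add: o_def)
  then show ?thesis by (rule borel_measurable_continuous_onI)
qed

section \<open>Measurability of continuous functions on the Wasserstein space\<close>

definition atoms :: "'i set \<Rightarrow> ('i \<Rightarrow> real) \<Rightarrow> ('i \<Rightarrow> 'a::euclidean_space) \<Rightarrow> 'a measure" where
  "atoms I w g = distr (point_measure I (\<lambda>i. ennreal (w i))) borel g"

lemma nn_integral_atoms:
  assumes "finite I" "f \<in> borel_measurable borel"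
  shows "(\<integral>\<^sup>+x. f x \<partial>atoms I w g) = (\<Sum>i\<in>I. ennreal (w i) * f (g i))"
  unfolding atoms_def
  by (subst nn_integral_distr) (use assms in \<open>simp_all add: nn_integral_point_measure_finite\<close>)

lemma emeasure_atoms:
  assumes "finite I" "\<And>i. i \<in> I \<Longrightarrow> 0 \<le> w i" "A \<in> sets borel"
  shows "emeasure (atoms I w g) A = ennreal (\<Sum>i\<in>I. w i * indicator A (g i))"
proof -
  have "emeasure (atoms I w g) A = (\<integral>\<^sup>+x. indicator A x \<partial>atoms I w g)"
    using assms(3) by (simp add: atoms_def)
  also have "\<dots> = (\<Sum>i\<in>I. ennreal (w i) * indicator A (g i))"
    using assms by (intro nn_integral_atoms) auto
  also have "\<dots> = (\<Sum>i\<in>I. ennreal (w i * indicator A (g i)))"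
    by (intro sum.cong) (auto simp: indicator_def)
  also have "\<dots> = ennreal (\<Sum>i\<in>I. w i * indicator A (g i))"
    using assms(2) by (intro sum_ennreal) auto
  finally show ?thesis .
qed

lemma atoms_eqI:
  assumes "finite I" "\<And>i. i \<in> I \<Longrightarrow> 0 \<le> w i" "finite J" "\<And>j. j \<in> J \<Longrightarrow> 0 \<le> v j"
    and "\<And>A. A \<in> sets borel \<Longrightarrow>
      (\<Sum>i\<in>I. w i * indicator A (g i)) = (\<Sum>j\<in>J. v j * indicator A (h j) :: real)"
  shows "atoms I w g = atoms J v h"
proof (rule measure_eqI)
  fix A assume "A \<in> sets (atoms I w g)"
  then have "A \<in> sets borel" by (simp add: atoms_def)
  then show "emeasure (atoms I w g) A = emeasure (atoms J v h) A"
    using assms by (simp add: emeasure_atoms)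
qed (simp add: atoms_def)

lemma atoms_in_P2:
  assumes "finite I" "\<And>i. i \<in> I \<Longrightarrow> 0 \<le> w i" "(\<Sum>i\<in>I. w i) = 1"
  shows "atoms I w g \<in> P2"
  unfolding P2_def
proof (intro CollectI conjI)
  show "prob_space (atoms I w g)"
  proof
    have "space (atoms I w g) = UNIV" by (simp add: atoms_def)
    then show "emeasure (atoms I w g) (space (atoms I w g)) = 1"
      using assms by (simp add: emeasure_atoms)
  qed
  show "sets (atoms I w g) = sets borel" by (simp add: atoms_def)
  have "(\<integral>\<^sup>+x. ennreal ((norm x)\<^sup>2) \<partial>atoms I w g) = (\<Sum>i\<in>I. ennreal (w i) * ennreal ((norm (g i))\<^sup>2))"
    by (rule nn_integral_atoms) (use assms(1) in auto)
  also have "\<dots> < \<infinity>" using assms(1) by (simp add: ennreal_mult_less_top)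
  finally show "(\<integral>\<^sup>+x. ennreal ((norm x)\<^sup>2) \<partial>atoms I w g) < \<infinity>" .
qed

text \<open>The atoms \<open>y \<noteq> y\<^sub>0\<close> receive the weights \<open>z y / k\<close>, and \<open>y\<^sub>0\<close> the mass that is left. Since \<open>z\<close> is
  integer-valued, only countably many measures arise for a given finite \<open>Y\<close> and given \<open>k\<close>.\<close>

definition rounded_atoms :: "'a::euclidean_space set \<Rightarrow> 'a \<Rightarrow> nat \<Rightarrow> ('a \<Rightarrow> int) \<Rightarrow> 'a measure" where
  "rounded_atoms Y y\<^sub>0 k z = atoms Y (\<lambda>y. if y = y\<^sub>0
     then 1 - (\<Sum>y\<in>Y - {y\<^sub>0}. of_int (z y) / real k) else of_int (z y) / real k) (\<lambda>y. y)"

text \<open>Rounding the weights down and moving the surplus of each atom to \<open>y\<^sub>0\<close> displaces a mass of at most \<open>1 / Suc k\<close> per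
  atom over distances that do not depend on \<open>k\<close>.\<close>

lemma
  fixes Y :: "'a::euclidean_space set" and z :: "nat \<Rightarrow> 'a \<Rightarrow> int"
  assumes Y: "finite Y" "y\<^sub>0 \<in> Y" and c: "\<And>y. y \<in> Y \<Longrightarrow> 0 \<le> c y" "(\<Sum>y\<in>Y. c y) = 1"
    and z: "\<And>k y. y \<in> Y \<Longrightarrow> z k y = \<lfloor>real (Suc k) * c y\<rfloor>"
  shows rounded_atoms_in_P2: "rounded_atoms Y y\<^sub>0 (Suc k) (z k) \<in> P2"
    and W2_rounded_atoms: "(\<lambda>k. W2 (atoms Y c (\<lambda>y. y)) (rounded_atoms Y y\<^sub>0 (Suc k) (z k))) \<longlonglongrightarrow> 0"
proof -
  define a where "a k y = (if y = y\<^sub>0 then c y else of_int (z k y) / real (Suc k))" for k y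
  \<comment> \<open>The transport plan lives on \<open>Y \<times> bool\<close>: the mass at \<open>(y, True)\<close> stays at \<open>y\<close>, the surplus at \<open>(y, False)\<close>
    moves to \<open>y\<^sub>0\<close>.\<close>
  define w where "w k p = (if snd p then a k (fst p) else c (fst p) - a k (fst p))" for k and p :: "'a \<times> bool"
  define h where "h p = (if snd p then fst p else y\<^sub>0)" for p :: "'a \<times> bool"
  define b where "b k y = (if y = y\<^sub>0
     then 1 - (\<Sum>y\<in>Y - {y\<^sub>0}. of_int (z k y) / real (Suc k)) else of_int (z k y) / real (Suc k))" for k y
  have a0: "0 \<le> a k y" "a k y \<le> c y" "c y - a k y \<le> 1 / real (Suc k)" if "y \<in> Y" for k y
  proof -
    have "0 \<le> z k y" "of_int (z k y) \<le> real (Suc k) * c y" "real (Suc k) * c y \<le> of_int (z k y) + 1"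
      unfolding z[OF that] using c(1)[OF that] by (auto simp: floor_correct less_imp_le simp del: of_nat_Suc)
    then show "0 \<le> a k y" "a k y \<le> c y" "c y - a k y \<le> 1 / real (Suc k)"
      using c(1)[OF that] by (auto simp: a_def field_simps simp del: of_nat_Suc)
  qed
  have w0: "0 \<le> w k p" if "p \<in> Y \<times> UNIV" for k p using a0 that by (auto simp: w_def)
  have c_y0: "c y\<^sub>0 = 1 - (\<Sum>y\<in>Y - {y\<^sub>0}. c y)" using c(2) Y by (simp add: sum.remove)
  have a_b: "(\<Sum>y\<in>Y - {y\<^sub>0}. of_int (z k y) / real (Suc k)) = (\<Sum>y\<in>Y - {y\<^sub>0}. a k y)" for k
    by (intro sum.cong) (auto simp: a_def)
  have b0: "0 \<le> b k y" if "y \<in> Y" for k y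
  proof (cases "y = y\<^sub>0")
    case True
    have "(\<Sum>y\<in>Y - {y\<^sub>0}. a k y) \<le> (\<Sum>y\<in>Y - {y\<^sub>0}. c y)" by (intro sum_mono a0) auto
    then show ?thesis using True c_y0 c(1)[OF that] by (simp add: b_def a_b del: of_nat_Suc)
  next
    case False
    then show ?thesis using a0(1)[OF that, of k] by (simp add: b_def a_def del: of_nat_Suc)
  qed
  have b1: "(\<Sum>y\<in>Y. b k y) = 1" for k
    using Y by (simp add: sum.remove b_def)
  have rounded: "rounded_atoms Y y\<^sub>0 (Suc k) (z k) = atoms Y (b k) (\<lambda>y. y)" for k
    by (simp add: rounded_atoms_def b_def[abs_def])
  show "rounded_atoms Y y\<^sub>0 (Suc k) (z k) \<in> P2"
    unfolding rounded by (intro atoms_in_P2 Y b0 b1)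
  have bool_sum: "(\<Sum>p\<in>Y \<times> UNIV. w k p * f p) = (\<Sum>y\<in>Y. a k y * f (y, True) + (c y - a k y) * f (y, False))"
    for k and f :: "'a \<times> bool \<Rightarrow> real"
  proof -
    have "(\<Sum>p\<in>Y \<times> UNIV. w k p * f p) = (\<Sum>y\<in>Y. \<Sum>b\<in>UNIV. w k (y, b) * f (y, b))"
      by (simp add: sum.cartesian_product)
    then show ?thesis by (simp add: UNIV_bool w_def add.commute)
  qed
  have left: "atoms Y c (\<lambda>y. y) = atoms (Y \<times> UNIV) (w k) fst" for k
  proof (rule atoms_eqI)
    fix A :: "'a set"
    show "(\<Sum>y\<in>Y. c y * indicator A y) = (\<Sum>p\<in>Y \<times> UNIV. w k p * indicator A (fst p) :: real)"
      unfolding bool_sum by (intro sum.cong) (auto simp: algebra_simps)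
  qed (use Y c w0 in auto)
  have right: "atoms Y (b k) (\<lambda>y. y) = atoms (Y \<times> UNIV) (w k) h" for k
  proof (rule atoms_eqI)
    fix A :: "'a set"
    let ?i = "indicator A :: 'a \<Rightarrow> real"
    have "(\<Sum>p\<in>Y \<times> UNIV. w k p * ?i (h p)) = (\<Sum>y\<in>Y. a k y * ?i y + (c y - a k y) * ?i y\<^sub>0)"
      unfolding bool_sum by (simp add: h_def)
    also have "\<dots> = c y\<^sub>0 * ?i y\<^sub>0 + (\<Sum>y\<in>Y - {y\<^sub>0}. a k y * ?i y + (c y - a k y) * ?i y\<^sub>0)"
      using Y by (simp add: sum.remove a_def)
    also have "\<dots> = (1 - (\<Sum>y\<in>Y - {y\<^sub>0}. a k y)) * ?i y\<^sub>0 + (\<Sum>y\<in>Y - {y\<^sub>0}. a k y * ?i y)"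
      by (simp add: c_y0 sum.distrib sum_subtractf algebra_simps flip: sum_distrib_left sum_distrib_right)
    also have "\<dots> = (\<Sum>y\<in>Y. b k y * ?i y)"
    proof -
      have "(\<Sum>y\<in>Y - {y\<^sub>0}. a k y * ?i y) = (\<Sum>y\<in>Y - {y\<^sub>0}. b k y * ?i y)"
        by (intro sum.cong) (auto simp: a_def b_def)
      moreover have "b k y\<^sub>0 = 1 - (\<Sum>y\<in>Y - {y\<^sub>0}. a k y)" unfolding a_b[symmetric] by (simp add: b_def)
      ultimately show ?thesis by (simp only: sum.remove[OF Y])
    qed
    finally show "(\<Sum>y\<in>Y. b k y * ?i y) = (\<Sum>p\<in>Y \<times> UNIV. w k p * ?i (h p))" by simp
  qed (use Y b0 w0 in auto)
  define K where "K = (\<Sum>y\<in>Y. (norm (y - y\<^sub>0))\<^sup>2)"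
  have cost: "(\<integral>\<^sup>+p. ennreal ((norm (fst p - h p))\<^sup>2) \<partial>point_measure (Y \<times> UNIV) (\<lambda>p. ennreal (w k p)))
      \<le> ennreal (1 / real (Suc k) * K)" for k
  proof -
    have "(\<integral>\<^sup>+p. ennreal ((norm (fst p - h p))\<^sup>2) \<partial>point_measure (Y \<times> UNIV) (\<lambda>p. ennreal (w k p)))
        = (\<Sum>p\<in>Y \<times> UNIV. ennreal (w k p) * ennreal ((norm (fst p - h p))\<^sup>2))"
      using Y(1) by (intro nn_integral_point_measure_finite) auto
    also have "\<dots> = (\<Sum>p\<in>Y \<times> UNIV. ennreal (w k p * (norm (fst p - h p))\<^sup>2))"
      using w0 by (intro sum.cong ennreal_mult[symmetric]) auto
    also have "\<dots> = ennreal (\<Sum>p\<in>Y \<times> UNIV. w k p * (norm (fst p - h p))\<^sup>2)"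
      using w0 by (intro sum_ennreal) auto
    also have "(\<Sum>p\<in>Y \<times> UNIV. w k p * (norm (fst p - h p))\<^sup>2) = (\<Sum>y\<in>Y. (c y - a k y) * (norm (y - y\<^sub>0))\<^sup>2)"
      unfolding bool_sum by (simp add: h_def)
    also have "ennreal (\<Sum>y\<in>Y. (c y - a k y) * (norm (y - y\<^sub>0))\<^sup>2) \<le> ennreal (1 / real (Suc k) * K)"
      unfolding K_def sum_distrib_left by (intro ennreal_leI sum_mono mult_right_mono a0) auto
    finally show ?thesis .
  qed
  have "(\<lambda>k. 1 / real (Suc k) * K) \<longlonglongrightarrow> 0 * K"
    by (intro tendsto_mult lim_1_over_real_power[of 1, simplified] tendsto_const LIMSEQ_Suc[OF lim_1_over_n])
  then have K_lim: "(\<lambda>k. ennreal (1 / real (Suc k) * K)) \<longlonglongrightarrow> 0"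
    using tendsto_ennrealI by fastforce
  have "(\<lambda>k. W2 (distr (point_measure (Y \<times> UNIV) (\<lambda>p. ennreal (w k p))) borel fst)
      (distr (point_measure (Y \<times> UNIV) (\<lambda>p. ennreal (w k p))) borel h)) \<longlonglongrightarrow> 0"
  proof (rule W2_distr_tendsto)
    show "(\<lambda>k. \<integral>\<^sup>+p. ennreal ((norm (fst p - h p))\<^sup>2) \<partial>point_measure (Y \<times> UNIV) (\<lambda>p. ennreal (w k p)))
        \<longlonglongrightarrow> 0"
      by (rule tendsto_sandwich[OF _ _ tendsto_const K_lim]) (use cost in auto)
  qed auto
  then show "(\<lambda>k. W2 (atoms Y c (\<lambda>y. y)) (rounded_atoms Y y\<^sub>0 (Suc k) (z k))) \<longlonglongrightarrow> 0"
    unfolding rounded right left atoms_def[symmetric] by (simp add: left[symmetric])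
qed

lemma
  fixes r :: "'a::euclidean_space \<Rightarrow> 'a"
  assumes P: "\<mu> \<in> P2" and r: "r \<in> borel_measurable borel" "finite (range r)"
  shows distr_finite_range: "distr \<mu> borel r = atoms (range r) (\<lambda>y. measure \<mu> (r -` {y})) (\<lambda>y. y)"
    and sum_finite_range: "(\<Sum>y\<in>range r. measure \<mu> (r -` {y})) = 1"
proof -
  interpret prob_space \<mu> using P2_D(1)[OF P] .
  note [measurable_cong] = P2_D(2)[OF P]
  note sp = P2_D(3)[OF P]
  note [measurable] = r(1)
  have eq: "measure \<mu> (r -` A) = (\<Sum>y\<in>range r. measure \<mu> (r -` {y}) * indicator A y)" for A
  proof -
    have S: "r -` {y} \<in> sets \<mu>" for y
      using measurable_sets[OF r(1), of "{y}"] by (simp add: P2_D(2)[OF P])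
    have "measure \<mu> (\<Union>y\<in>range r \<inter> A. r -` {y}) = (\<Sum>y\<in>range r \<inter> A. measure \<mu> (r -` {y}))"
      by (rule finite_measure_finite_Union) (use r(2) S in \<open>auto simp: disjoint_family_on_def\<close>)
    also have "(\<Union>y\<in>range r \<inter> A. r -` {y}) = r -` A" by auto
    also have "(\<Sum>y\<in>range r \<inter> A. measure \<mu> (r -` {y})) =
        (\<Sum>y\<in>range r. if y \<in> A then measure \<mu> (r -` {y}) else 0)"
      by (rule sum.inter_restrict[OF r(2)])
    also have "\<dots> = (\<Sum>y\<in>range r. measure \<mu> (r -` {y}) * indicator A y)"
      by (intro sum.cong) (auto simp: indicator_def)
    finally show ?thesis .
  qed
  show "distr \<mu> borel r = atoms (range r) (\<lambda>y. measure \<mu> (r -` {y})) (\<lambda>y. y)"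
  proof (rule measure_eqI)
    fix A assume "A \<in> sets (distr \<mu> borel r)"
    then have A: "A \<in> sets borel" by simp
    have "emeasure (distr \<mu> borel r) A = ennreal (measure \<mu> (r -` A))"
      using A by (subst emeasure_distr) (auto simp: sp emeasure_eq_measure)
    also have "\<dots> = emeasure (atoms (range r) (\<lambda>y. measure \<mu> (r -` {y})) (\<lambda>y. y)) A"
      using A r(2) by (simp add: emeasure_atoms eq[of A, symmetric])
    finally show "emeasure (distr \<mu> borel r) A = emeasure (atoms (range r) (\<lambda>y. measure \<mu> (r -` {y})) (\<lambda>y. y)) A" .
  qed (simp add: atoms_def)
  show "(\<Sum>y\<in>range r. measure \<mu> (r -` {y})) = 1"
    using eq[of UNIV] prob_space by (simp add: sp)
qed

text \<open>The \<open>\<sigma>\<close>-algebra of \<open>S\<close> has to see \<open>\<mu>\<close> only through the numbers \<open>\<mu>(A)\<close>: \<open>V\<close> is an iterated pointwise limit of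
  functions that depend on \<open>\<mu>\<close> through a quantity with countably many values, computed from finitely many such
  numbers.\<close>

lemma continuous_map_P2_measurable:
  fixes V :: "'a::euclidean_space \<times> 'a measure \<Rightarrow> 'b::metric_space"
  assumes V: "continuous_map (prod_topology euclidean P2_topology) euclidean V"
    and S: "fst \<in> borel_measurable S" "snd \<in> measurable S (subprob_algebra borel)" "snd ` space S \<subseteq> P2"
  shows "V \<in> borel_measurable S"
proof -
  have P: "snd \<omega> \<in> P2" if "\<omega> \<in> space S" for \<omega> using S(3) that by blast
  \<comment> \<open>The inner limit: for fixed \<open>r\<close> the image measure is finitely supported, and its weights are rounded.\<close>
  have simple: "(\<lambda>\<omega>. V (fst \<omega>, distr (snd \<omega>) borel r)) \<in> borel_measurable S"
    if r: "r \<in> borel_measurable borel" "finite (range r)" for r :: "'a \<Rightarrow> 'a"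
  proof -
    define Y where "Y = range r"
    define z where "z k \<omega> = (\<lambda>y\<in>Y. \<lfloor>real (Suc k) * measure (snd \<omega>) (r -` {y})\<rfloor>)" 
      for k and \<omega> :: "'a \<times> 'a measure"
    note round = r(2)[folded Y_def] rangeI[of r 0, folded Y_def] measure_nonneg
      sum_finite_range[OF P r, folded Y_def]
    have in_P2: "rounded_atoms Y (r 0) (Suc k) (z k \<omega>) \<in> P2" if "\<omega> \<in> space S" for k \<omega>
      by (rule rounded_atoms_in_P2[where c="\<lambda>y. measure (snd \<omega>) (r -` {y})", OF round])
        (auto simp: that z_def)
    have "(\<lambda>\<omega>. V (fst \<omega>, rounded_atoms Y (r 0) (Suc k) (z k \<omega>))) \<in> borel_measurable S" for k
    proof (rule measurable_compose_countable'[where g="z k" and I="z k ` space S"])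
      have meas: "(\<lambda>\<omega>. measure (snd \<omega>) (r -` {y})) \<in> borel_measurable S" for y
        using measurable_sets[OF r(1), of "{y}"]
        by (intro measurable_compose[OF S(2)] measurable_measure_subprob_algebra) simp
      have "z k ` space S \<subseteq> Y \<rightarrow>\<^sub>E UNIV" by (auto simp: z_def)
      then show cnt: "countable (z k ` space S)"
        by (rule countable_subset) (use round(1) in \<open>auto intro: countable_PiE\<close>)
      show "z k \<in> measurable S (count_space (z k ` space S))"
        unfolding measurable_count_space_eq_countable[OF cnt]
      proof (intro conjI ballI)
        fix x assume "x \<in> z k ` space S"
        then have "x \<in> extensional Y" by (auto simp: z_def)
        then have "z k -` {x} \<inter> space S =
            {\<omega>\<in>space S. \<forall>y\<in>Y. \<lfloor>real (Suc k) * measure (snd \<omega>) (r -` {y})\<rfloor> = x y}"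
          by (auto simp: z_def extensional_def fun_eq_iff)
        also have "\<dots> \<in> sets S"
        proof (rule sets.sets_Collect_finite_All[OF _ round(1)])
          fix y
          note [measurable] = meas[of y]
          show "{\<omega>\<in>space S. \<lfloor>real (Suc k) * measure (snd \<omega>) (r -` {y})\<rfloor> = x y} \<in> sets S"
            by measurable
        qed
        finally show "z k -` {x} \<inter> space S \<in> sets S" .
      qed auto
      fix x assume "x \<in> z k ` space S"
      then have "rounded_atoms Y (r 0) (Suc k) x \<in> P2" using in_P2 by auto
      then show "(\<lambda>\<omega>. V (fst \<omega>, rounded_atoms Y (r 0) (Suc k) x)) \<in> borel_measurable S"
        by (intro measurable_compose[OF S(1) continuous_map_P2_section[OF V]])
    qed
    then show ?thesis
    proof (rule borel_measurable_LIMSEQ_metric)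
      fix \<omega> assume \<omega>: "\<omega> \<in> space S"
      have atoms: "distr (snd \<omega>) borel r = atoms Y (\<lambda>y. measure (snd \<omega>) (r -` {y})) (\<lambda>y. y)"
        unfolding Y_def by (rule distr_finite_range[OF P[OF \<omega>] r])
      show "(\<lambda>k. V (fst \<omega>, rounded_atoms Y (r 0) (Suc k) (z k \<omega>))) \<longlonglongrightarrow> V (fst \<omega>, distr (snd \<omega>) borel r)"
      proof (rule continuous_map_P2_tendsto[OF V])
        show "distr (snd \<omega>) borel r \<in> P2"
          unfolding atoms by (intro atoms_in_P2 round(1,4) \<omega> measure_nonneg)
        show "(\<lambda>k. W2 (distr (snd \<omega>) borel r) (rounded_atoms Y (r 0) (Suc k) (z k \<omega>))) \<longlonglongrightarrow> 0"
          unfolding atoms by (rule W2_rounded_atoms[OF round]) (auto simp: \<omega> z_def)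
      qed (rule in_P2[OF \<omega>])
    qed
  qed
  \<comment> \<open>The outer limit: the image of \<open>\<mu>\<close> under \<open>r n\<close> converges to \<open>\<mu>\<close>, by dominated convergence with the second
    moment of \<open>\<mu>\<close> as majorant.\<close>
  obtain r :: "nat \<Rightarrow> 'a \<Rightarrow> 'a" where r: "\<And>n. simple_function borel (r n)" "\<And>x. (\<lambda>n. r n x) \<longlonglongrightarrow> x"
    "\<And>n x. norm (r n x) \<le> 2 * norm x"
    using borel_measurable_implies_sequence_metric[of "\<lambda>x::'a. x" borel 0] by (auto simp: dist_norm)
  have r_m: "r n \<in> borel_measurable borel" "finite (range (r n))" for n
    using borel_measurable_simple_function[OF r(1)] simple_functionD(1)[OF r(1), of n] by auto
  show ?thesis
  proof (rule borel_measurable_LIMSEQ_metric[OF simple[OF r_m]])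
    fix \<omega> assume \<omega>: "\<omega> \<in> space S"
    let ?\<mu> = "snd \<omega>"
    note [measurable_cong] = P2_D(2)[OF P[OF \<omega>]]
    note [measurable] = r_m(1)
    have "(\<lambda>n. V (fst \<omega>, distr ?\<mu> borel (r n))) \<longlonglongrightarrow> V (fst \<omega>, ?\<mu>)"
    proof (rule continuous_map_P2_tendsto[OF V P[OF \<omega>]])
      show "distr ?\<mu> borel (r n) \<in> P2" for n
        unfolding distr_finite_range[OF P[OF \<omega>] r_m]
        by (intro atoms_in_P2 r_m(2) sum_finite_range[OF P[OF \<omega>] r_m] measure_nonneg)
      have "(\<lambda>n. \<integral>\<^sup>+x. ennreal ((norm (x - r n x))\<^sup>2) \<partial>?\<mu>) \<longlonglongrightarrow> (\<integral>\<^sup>+x. 0 \<partial>?\<mu>)"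
      proof (rule nn_integral_dominated_convergence[where w="\<lambda>x. 9 * ennreal ((norm x)\<^sup>2)"])
        show "AE x in ?\<mu>. ennreal ((norm (x - r n x))\<^sup>2) \<le> 9 * ennreal ((norm x)\<^sup>2)" for n
        proof (rule AE_I2)
          fix x
          have "norm (x - r n x) \<le> 3 * norm x" using norm_triangle_ineq4[of x "r n x"] r(3)[of n x] by simp
          then have "(norm (x - r n x))\<^sup>2 \<le> (3 * norm x)\<^sup>2" by (rule power_mono) simp
          then have "ennreal ((norm (x - r n x))\<^sup>2) \<le> ennreal (9 * (norm x)\<^sup>2)"
            by (intro ennreal_leI) (simp add: power_mult_distrib)
          also have "\<dots> = 9 * ennreal ((norm x)\<^sup>2)" by (subst ennreal_mult) auto
          finally show "ennreal ((norm (x - r n x))\<^sup>2) \<le> 9 * ennreal ((norm x)\<^sup>2)" .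
        qed
        show "(\<integral>\<^sup>+x. 9 * ennreal ((norm x)\<^sup>2) \<partial>?\<mu>) < \<infinity>"
          using P2_D(4)[OF P[OF \<omega>]] by (subst nn_integral_cmult) (auto simp: ennreal_mult_less_top)
        show "AE x in ?\<mu>. (\<lambda>n. ennreal ((norm (x - r n x))\<^sup>2)) \<longlonglongrightarrow> 0"
        proof (rule AE_I2)
          fix x
          have "(\<lambda>n. ennreal ((norm (x - r n x))\<^sup>2)) \<longlonglongrightarrow> ennreal ((norm (x - x))\<^sup>2)"
            by (intro tendsto_intros r(2) tendsto_ennrealI)
          then show "(\<lambda>n. ennreal ((norm (x - r n x))\<^sup>2)) \<longlonglongrightarrow> 0" by simp
        qed
      qed auto
      then have "(\<lambda>n. W2 (distr ?\<mu> borel (\<lambda>x. x)) (distr ?\<mu> borel (r n))) \<longlonglongrightarrow> 0"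
        by (intro W2_distr_tendsto[where N="\<lambda>_. ?\<mu>" and g="\<lambda>_ x. x"]) auto
      then show "(\<lambda>n. W2 ?\<mu> (distr ?\<mu> borel (r n))) \<longlonglongrightarrow> 0"
        by (simp add: distr_id2 P2_D(2)[OF P[OF \<omega>]])
    qed
    then show "(\<lambda>n. V (fst \<omega>, distr (snd \<omega>) borel (r n))) \<longlonglongrightarrow> V \<omega>" by simp
  qed
qed

section \<open>The features and the joint law\<close>

definition coords :: "(real^'d \<Rightarrow> real) set" where
  "coords = range (\<lambda>i x. x $ i)"

definition features :: "(real \<Rightarrow> real) \<Rightarrow> ((real^'d) \<times> (real^'d) measure \<Rightarrow> real) set" where
  "features s = range (\<lambda>i \<omega>. fst \<omega> $ i) \<union> (\<lambda>\<phi> \<omega>. \<integral>x. \<phi> x \<partial>snd \<omega>) ` net s coords"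

text \<open>The \<open>\<sigma>\<close>-algebra is generated by the features alone, which is the hypothesis of \<open>net_dense_L2\<close>; that it is large
  enough for \<open>V\<close> is the content of \<open>fst_feature_space\<close>, \<open>snd_feature_space\<close> and
  \<open>continuous_map_P2_measurable\<close>.\<close>

definition feature_space :: "(real \<Rightarrow> real) \<Rightarrow> ((real^'d) \<times> (real^'d) measure) measure" where
  "feature_space s = sigma (UNIV \<times> P2) {{\<omega>\<in>UNIV \<times> P2. a \<le> X \<omega>} | X a. X \<in> features s}"

lemma space_feature_space: "space (feature_space s) = UNIV \<times> P2"
  and sets_feature_space: "sets (feature_space s) =
    sigma_sets (UNIV \<times> P2) {{\<omega>\<in>UNIV \<times> P2. a \<le> X \<omega>} | X a. X \<in> features s}"
proof -
  have *: "{{\<omega>\<in>UNIV \<times> P2. a \<le> X \<omega>} | X a. X \<in> features s} \<subseteq> Pow (UNIV \<times> P2)" by blast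
  show "space (feature_space s) = UNIV \<times> P2" unfolding feature_space_def by (rule space_measure_of[OF *])
  show "sets (feature_space s) =
      sigma_sets (UNIV \<times> P2) {{\<omega>\<in>UNIV \<times> P2. a \<le> X \<omega>} | X a. X \<in> features s}"
    unfolding feature_space_def by (rule sets_measure_of[OF *])
qed

lemma features_measurable: "features s \<subseteq> borel_measurable (feature_space s)"
proof
  fix X assume "X \<in> features s"
  then show "X \<in> borel_measurable (feature_space s)"
    unfolding borel_measurable_iff_ge sets_feature_space space_feature_space
    by (blast intro: sigma_sets.Basic)
qed

lemma measurable_into_feature_space:
  fixes f :: "'a \<Rightarrow> (real^'d) \<times> (real^'d) measure"
  assumes "f \<in> space T \<rightarrow> UNIV \<times> P2" "\<And>X. X \<in> features s \<Longrightarrow> (\<lambda>t. X (f t)) \<in> borel_measurable T"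
  shows "f \<in> measurable T (feature_space s)"
proof (rule measurable_sigma_sets[OF sets_feature_space _ assms(1)])
  fix A :: "((real^'d) \<times> (real^'d) measure) set"
  assume "A \<in> {{\<omega>\<in>UNIV \<times> P2. a \<le> X \<omega>} | X a. X \<in> features s}"
  then obtain X a where X: "X \<in> features s" "A = {\<omega>\<in>UNIV \<times> P2. a \<le> X \<omega>}" by blast
  note [measurable] = assms(2)[OF X(1)]
  have "f -` A \<inter> space T = {t\<in>space T. a \<le> X (f t)}" using assms(1) unfolding X(2) by auto
  also have "\<dots> \<in> sets T" by measurable
  finally show "f -` A \<inter> space T \<in> sets T" .
qed blast

lemma fst_feature_space: "fst \<in> borel_measurable (feature_space s :: ((real^'d) \<times> (real^'d) measure) measure)"
proof (rule borel_measurable_euclidean_space[THEN iffD2], rule ballI)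
  fix b :: "real^'d" assume "b \<in> Basis"
  then obtain i where b: "b = axis i 1" by (auto simp: Basis_vec_def)
  have "(\<lambda>\<omega> :: (real^'d) \<times> (real^'d) measure. fst \<omega> $ i) \<in> features s" by (simp add: features_def)
  then show "(\<lambda>\<omega> :: (real^'d) \<times> (real^'d) measure. fst \<omega> \<bullet> b) \<in> borel_measurable (feature_space s)"
    using features_measurable by (auto simp: b inner_axis)
qed

lemma sets_borel_coords:
  "sets (borel :: (real^'d) measure) = sigma_sets UNIV {{x\<in>UNIV. a \<le> X x} | X a. X \<in> coords}"
proof -
  have "(\<lambda>(a, i). {x::real^'d. a \<le> x \<bullet> i}) ` (UNIV \<times> Basis) = {{x\<in>UNIV. a \<le> X x} | X a. X \<in> coords}"
  proof (intro equalityI subsetI)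
    fix A assume "A \<in> (\<lambda>(a, i). {x::real^'d. a \<le> x \<bullet> i}) ` (UNIV \<times> Basis)"
    then obtain a b where A: "A = {x. a \<le> x \<bullet> b}" and "b \<in> Basis"
      by (elim imageE SigmaE) simp
    then obtain i where "b = axis i 1" by (auto simp: Basis_vec_def)
    with A have "A = {x\<in>UNIV. a \<le> x $ i}" by (simp add: inner_axis)
    then show "A \<in> {{x\<in>UNIV. a \<le> X x} | X a. X \<in> coords}"
      unfolding coords_def by (intro CollectI exI[of _ "\<lambda>x. x $ i"] exI[of _ a] conjI) auto
  next
    fix A :: "(real^'d) set" assume "A \<in> {{x\<in>UNIV. a \<le> X x} | X a. X \<in> coords}"
    then obtain a i where "A = {x. a \<le> x $ i}" unfolding coords_def by auto
    then have "A = (\<lambda>(a, i). {x. a \<le> x \<bullet> i}) (a, axis i 1)" by (simp add: inner_axis)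
    then show "A \<in> (\<lambda>(a, i). {x::real^'d. a \<le> x \<bullet> i}) ` (UNIV \<times> Basis)"
      by (rule image_eqI) (simp add: axis_in_Basis_iff)
  qed
  then show ?thesis by (subst borel_eq_halfspace_ge) (simp only: sets_measure_of subset_UNIV Pow_UNIV)
qed

lemma coords_measurable: "coords \<subseteq> borel_measurable borel"
proof
  fix X :: "real^'d \<Rightarrow> real" assume "X \<in> coords"
  then obtain i where "X = (\<lambda>x. x $ i)" by (auto simp: coords_def)
  moreover have "continuous_on UNIV (\<lambda>x::real^'d. x $ i)" by (intro continuous_intros)
  ultimately show "X \<in> borel_measurable borel" by (simp add: borel_measurable_continuous_onI)
qed

text \<open>For an orthant \<open>A\<close> the number \<open>\<mu>(A)\<close> is the limit of \<open>\<langle>f\<^sub>n, \<mu>\<rangle>\<close> for networks \<open>f\<^sub>n\<close> converging boundedly to the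
  indicator of \<open>A\<close>, and the orthants generate the Borel sets.\<close>

lemma snd_feature_space:
  fixes s :: "real \<Rightarrow> real"
  assumes s: "squashing s"
  shows "snd \<in> measurable (feature_space s) (subprob_algebra (borel :: (real^'d) measure))"
proof (rule measurable_subprob_algebra_generated)
  let ?S = "feature_space s :: ((real^'d) \<times> (real^'d) measure) measure"
  let ?G = "orthants UNIV (coords :: (real^'d \<Rightarrow> real) set)"
  have P: "prob_space (snd \<omega>)" "sets (snd \<omega>) = sets borel" if "\<omega> \<in> space ?S" for \<omega>
  proof -
    have "snd \<omega> \<in> P2" using that by (simp add: space_feature_space mem_Times_iff)
    then show "prob_space (snd \<omega>)" "sets (snd \<omega>) = sets borel" by (rule P2_D)+
  qed
  show "subprob_space (snd \<omega>)" "sets (snd \<omega>) = sets borel" if "\<omega> \<in> space ?S" for \<omega>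
    using P[OF that] by (auto intro: prob_space_imp_subprob_space)
  show gen: "sets (borel :: (real^'d) measure) = sigma_sets UNIV ?G"
    unfolding sets_borel_coords by (rule sigma_sets_orthants)
  show "Int_stable ?G" by (rule Int_stable_orthants)
  show "?G \<subseteq> Pow UNIV" by simp
  have "(\<lambda>\<omega>. emeasure (snd \<omega>) UNIV) \<in> borel_measurable ?S \<longleftrightarrow> (\<lambda>_. 1 :: ennreal) \<in> borel_measurable ?S"
  proof (rule measurable_cong)
    fix \<omega> assume "\<omega> \<in> space ?S"
    then show "emeasure (snd \<omega>) UNIV = 1"
      using prob_space.emeasure_space_1[OF P(1)] sets_eq_imp_space_eq[OF P(2)] by fastforce
  qed
  then show "(\<lambda>\<omega>. emeasure (snd \<omega>) UNIV) \<in> borel_measurable ?S" by simp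
  fix A assume A: "A \<in> ?G"
  then have A_sets: "A \<in> sets borel" unfolding gen by (rule sigma_sets.Basic)
  obtain F where F: "finite F" "F \<subseteq> coords \<times> UNIV" "A = {x\<in>UNIV. \<forall>(X, a)\<in>F. a \<le> X x}"
    using A unfolding orthants_def by blast
  obtain f where f: "\<And>n. f n \<in> net s coords" "\<And>n x. \<bar>f n x\<bar> \<le> 1"
    "\<And>x. (\<lambda>n. f n x) \<longlonglongrightarrow> (if \<forall>(X, a)\<in>F. a \<le> X x then 1 else 0)"
    using orthant_net_limit[OF s F(1,2)] by blast
  have f_lim: "(\<lambda>n. f n x) \<longlonglongrightarrow> indicator A x" for x
  proof -
    have "indicator A x = (if \<forall>(X, a)\<in>F. a \<le> X x then 1 else 0 :: real)"
      by (auto simp: F(3) indicator_def)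
    then show ?thesis using f(3)[of x] by (simp only:)
  qed
  have "(\<lambda>\<omega>. measure (snd \<omega>) A) \<in> borel_measurable ?S"
  proof (rule borel_measurable_LIMSEQ_metric)
    show "(\<lambda>\<omega>. \<integral>x. f n x \<partial>snd \<omega>) \<in> borel_measurable ?S" for n
      using f(1)[of n] features_measurable[of s] by (auto simp: features_def)
    fix \<omega> assume \<omega>: "\<omega> \<in> space ?S"
    interpret prob_space "snd \<omega>" by (rule P(1)[OF \<omega>])
    note [measurable_cong] = P(2)[OF \<omega>]
    have [measurable]: "f n \<in> borel_measurable borel" for n
      by (rule net_measurable[OF s f(1) coords_measurable])
    have "(\<lambda>n. \<integral>x. f n x \<partial>snd \<omega>) \<longlonglongrightarrow> (\<integral>x. indicator A x \<partial>snd \<omega>)"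
      by (rule integral_dominated_convergence[where w="\<lambda>_. 1"]) (use f_lim f(2) A_sets in auto)
    then show "(\<lambda>n. \<integral>x. f n x \<partial>snd \<omega>) \<longlonglongrightarrow> measure (snd \<omega>) A"
      using A_sets by (simp add: P(2)[OF \<omega>])
  qed
  then have "(\<lambda>\<omega>. ennreal (measure (snd \<omega>) A)) \<in> borel_measurable ?S" by simp
  moreover have "emeasure (snd \<omega>) A = ennreal (measure (snd \<omega>) A)" if "\<omega> \<in> space ?S" for \<omega>
    by (rule finite_measure.emeasure_eq_measure, rule prob_space.finite_measure, rule P(1)[OF that])
  ultimately show "(\<lambda>\<omega>. emeasure (snd \<omega>) A) \<in> borel_measurable ?S"
    by (simp cong: measurable_cong)
qed

lemma net_mean_measurable:
  assumes s: "squashing s" and \<phi>: "\<phi> \<in> net s (coords :: (real^'d \<Rightarrow> real) set)"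
  shows "(\<lambda>\<mu>. \<integral>x. \<phi> x \<partial>\<mu>) \<in> borel_measurable P2_borel"
proof -
  have "\<exists>L. L-lipschitz_on UNIV \<phi>"
  proof (rule net_lipschitz[OF s \<phi>])
    fix g :: "real^'d \<Rightarrow> real" assume "g \<in> coords"
    then obtain i where "g = (\<lambda>x. x $ i)" by (auto simp: coords_def)
    then have "1-lipschitz_on UNIV g" by (auto intro!: lipschitz_onI simp: dist_vec_nth_le)
    then show "\<exists>L. L-lipschitz_on UNIV g" by blast
  qed
  moreover obtain B where "\<And>x. \<bar>\<phi> x\<bar> \<le> B" using net_bounded[OF s \<phi>] by blast
  ultimately show ?thesis using integral_lipschitz_P2_borel by blast
qed

text \<open>The law of \<open>(x, \<mu>)\<close> when \<open>\<mu>\<close> is drawn from \<open>\<nu>\<close> and then \<open>x\<close> from \<open>\<mu>\<close>.\<close>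

definition joint_law :: "(real \<Rightarrow> real) \<Rightarrow> (real^'d) measure measure \<Rightarrow> ((real^'d) \<times> (real^'d) measure) measure" where
  "joint_law s \<nu> = \<nu> \<bind> (\<lambda>\<mu>. distr \<mu> (feature_space s) (\<lambda>x. (x, \<mu>)))"

context
  fixes s :: "real \<Rightarrow> real" and \<nu> :: "(real^'d) measure measure"
  assumes s: "squashing s" and prob: "prob_space \<nu>" and sets: "sets \<nu> = sets P2_borel"
begin

lemma space_nu: "space \<nu> = P2"
  using sets_eq_imp_space_eq[OF sets] by (simp add: space_P2_borel)

text \<open>That \<open>\<mu>\<close> depends measurably on itself, as a kernel on the Borel \<open>\<sigma>\<close>-algebra of \<open>P2\<close>, follows by
  factoring the identity through the section \<open>\<mu> \<mapsto> (0, \<mu>)\<close> of the feature space.\<close>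

lemma joint_law_kernel_measurable:
  "(\<lambda>\<mu>. distr \<mu> (feature_space s) (\<lambda>x. (x, \<mu>))) \<in> measurable \<nu> (subprob_algebra (feature_space s))"
proof (rule measurable_distr2)
  note [measurable_cong] = sets
  have "(\<lambda>\<mu>. (0, \<mu>)) \<in> measurable \<nu> (feature_space s)"
    by (rule measurable_into_feature_space)
      (auto simp: space_nu features_def net_mean_measurable[OF s] measurable_cong_sets[OF sets refl])
  from measurable_compose[OF this snd_feature_space[OF s]]
  show "(\<lambda>\<mu>. \<mu>) \<in> measurable \<nu> (subprob_algebra borel)" by simp
  show "(\<lambda>(\<mu>, x). (x, \<mu>)) \<in> measurable (\<nu> \<Otimes>\<^sub>M borel) (feature_space s)"
  proof (rule measurable_into_feature_space)
    fix X :: "(real^'d) \<times> (real^'d) measure \<Rightarrow> real" assume "X \<in> features s"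
    then consider i where "X = (\<lambda>\<omega>. fst \<omega> $ i)"
      | \<phi> where "\<phi> \<in> net s coords" "X = (\<lambda>\<omega>. \<integral>x. \<phi> x \<partial>snd \<omega>)"
      unfolding features_def by blast
    then show "(\<lambda>t. X (case t of (\<mu>, x) \<Rightarrow> (x, \<mu>))) \<in> borel_measurable (\<nu> \<Otimes>\<^sub>M borel)"
    proof cases
      case 1
      have [measurable]: "(\<lambda>x::real^'d. x $ i) \<in> borel_measurable borel"
        using coords_measurable by (auto simp: coords_def)
      show ?thesis unfolding 1 by (simp add: case_prod_beta)
    next
      case 2
      have [measurable]: "(\<lambda>\<mu>. \<integral>x. \<phi> x \<partial>\<mu>) \<in> borel_measurable \<nu>"
        using net_mean_measurable[OF s 2(1)] by (simp add: measurable_cong_sets[OF sets refl])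
      have "(\<lambda>t. (\<lambda>\<mu>. \<integral>x. \<phi> x \<partial>\<mu>) (fst t)) \<in> borel_measurable (\<nu> \<Otimes>\<^sub>M (borel :: (real^'d) measure))"
        by measurable
      then show ?thesis unfolding 2(2) by (simp add: case_prod_beta)
    qed
  qed (auto simp: space_pair_measure space_nu)
qed

lemma sets_joint_law: "sets (joint_law s \<nu>) = sets (feature_space s)"
  unfolding joint_law_def using prob_space.not_empty[OF prob] by (intro sets_bind) auto

lemma space_joint_law: "space (joint_law s \<nu>) = UNIV \<times> P2"
  using sets_eq_imp_space_eq[OF sets_joint_law] by (simp add: space_feature_space)

lemma finite_measure_joint_law: "finite_measure (joint_law s \<nu>)"
  unfolding joint_law_def
  using subprob_space_bind[OF prob_space_imp_subprob_space[OF prob] joint_law_kernel_measurable]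
  by (rule subprob_space.axioms)

lemma nn_integral_joint_law:
  assumes "f \<in> borel_measurable (feature_space s)"
  shows "(\<integral>\<^sup>+\<omega>. f \<omega> \<partial>joint_law s \<nu>) = (\<integral>\<^sup>+\<mu>. \<integral>\<^sup>+x. f (x, \<mu>) \<partial>\<mu> \<partial>\<nu>)"
proof -
  have "(\<integral>\<^sup>+\<omega>. f \<omega> \<partial>joint_law s \<nu>) =
      (\<integral>\<^sup>+\<mu>. \<integral>\<^sup>+\<omega>. f \<omega> \<partial>distr \<mu> (feature_space s) (\<lambda>x. (x, \<mu>)) \<partial>\<nu>)"
    unfolding joint_law_def by (rule nn_integral_bind[OF assms joint_law_kernel_measurable])
  also have "\<dots> = (\<integral>\<^sup>+\<mu>. \<integral>\<^sup>+x. f (x, \<mu>) \<partial>\<mu> \<partial>\<nu>)"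
  proof (rule nn_integral_cong)
    fix \<mu> assume "\<mu> \<in> space \<nu>"
    then have \<mu>: "\<mu> \<in> P2" by (simp add: space_nu)
    have "(\<lambda>x. (x, \<mu>)) \<in> measurable \<mu> (feature_space s)"
    proof (rule measurable_into_feature_space)
      fix X :: "(real^'d) \<times> (real^'d) measure \<Rightarrow> real" assume "X \<in> features s"
      moreover have "(\<lambda>x::real^'d. x $ i) \<in> borel_measurable \<mu>" for i
        using coords_measurable by (auto simp: coords_def measurable_cong_sets[OF P2_D(2)[OF \<mu>] refl])
      ultimately show "(\<lambda>x. X (x, \<mu>)) \<in> borel_measurable \<mu>" by (auto simp: features_def)
    qed (use \<mu> in auto)
    then show "(\<integral>\<^sup>+\<omega>. f \<omega> \<partial>distr \<mu> (feature_space s) (\<lambda>x. (x, \<mu>))) = (\<integral>\<^sup>+x. f (x, \<mu>) \<partial>\<mu>)"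
      using assms by (simp add: nn_integral_distr)
  qed
  finally show ?thesis .
qed

end

lemma norm_vec_sq: "(norm (x :: real^'p))\<^sup>2 = (\<Sum>i\<in>UNIV. (x $ i)\<^sup>2)"
  by (simp add: norm_vec_def L2_set_def sum_nonneg)

section \<open>Assembling the two networks\<close>

text \<open>The components use finitely many features, hence finitely many inner networks \<open>p\<^sub>0, \<dots>, p\<^bsub>k-1\<^esub>\<close>. These are the components
  of \<open>\<phi>\<close>, and their means are the last \<open>k\<close> inputs of \<open>\<Psi>\<close>.\<close>

lemma networks_of_nets:
  fixes f :: "'p::finite \<Rightarrow> (real^'d) \<times> (real^'d) measure \<Rightarrow> real"
  assumes f: "\<And>i. f i \<in> net \<sigma> (features s)"
    and sub: "net s (coords :: (real^'d \<Rightarrow> real) set) \<subseteq> net \<sigma> coords"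
  shows "\<exists>(k::nat) (\<Psi> :: ('d + nat \<Rightarrow> real) \<Rightarrow> 'p \<Rightarrow> real) (\<phi> :: ('d \<Rightarrow> real) \<Rightarrow> nat \<Rightarrow> real).
    k \<ge> 1 \<and> neural_network \<sigma> (UNIV <+> {..<k}) UNIV \<Psi> \<and> neural_network \<sigma> UNIV {..<k} \<phi> \<and>
    (\<forall>x \<mu> i. \<Psi> (case_sum (vec_nth x) (mean_embedding k (\<lambda>y. \<phi> (vec_nth y)) \<mu>)) i = f i (x, \<mu>))"
proof -
  define mean where "mean \<phi> \<omega> = (\<integral>x. \<phi> x \<partial>snd \<omega>)"
    for \<phi> :: "real^'d \<Rightarrow> real" and \<omega> :: "(real^'d) \<times> (real^'d) measure"
  have features: "features s = range (\<lambda>i \<omega>. fst \<omega> $ i) \<union> mean ` net s coords"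
    by (simp add: features_def mean_def[abs_def])
  obtain F where F: "finite F" "F \<subseteq> features s" "\<And>i. f i \<in> net \<sigma> F"
    using net_finite_family[of UNIV f \<sigma> "features s"] f by auto
  have "F - range (\<lambda>i \<omega>. fst \<omega> $ i) \<subseteq> mean ` net s coords" using F(2) unfolding features by blast
  from finite_subset_image[OF finite_Diff[OF F(1)] this]
  obtain P' where P': "P' \<subseteq> net s coords" "finite P'" "F - range (\<lambda>i \<omega>. fst \<omega> $ i) = mean ` P'"
    by (elim exE conjE) (rule that)
  \<comment> \<open>The zero network is added to ensure \<open>k \<ge> 1\<close>.\<close>
  define P where "P = insert (\<lambda>_. 0) P'"
  have P: "finite P" "P \<noteq> {}" "P \<subseteq> net s coords"
    using P'(1,2) affine_span.const[of 0] unfolding P_def net_def by auto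
  define k where "k = card P"
  have k: "k \<ge> 1" using P(1,2) by (simp add: k_def Suc_le_eq card_gt_0_iff)
  obtain p where p: "P = p ` {..<k}"
    using ex_bij_betw_nat_finite[OF P(1)] unfolding k_def
    by (auto simp: bij_betw_def lessThan_atLeast0)
  have p_net: "p j \<in> net \<sigma> (range (\<lambda>i x. x $ i))" if "j \<in> {..<k}" for j
    using that p P(3) sub unfolding coords_def by blast
  obtain \<phi> where \<phi>: "neural_network \<sigma> UNIV {..<k} \<phi>"
    "\<And>z (x :: real^'d). (\<forall>i\<in>UNIV. z i = x $ i) \<Longrightarrow> \<forall>j\<in>{..<k}. \<phi> z j = p j x"
    using net_is_neural_network[of UNIV "{..<k}" p \<sigma> "\<lambda>i x. x $ i", OF _ _ p_net] by auto
  define h where "h = case_sum (\<lambda>i \<omega>. fst \<omega> $ i) (\<lambda>j. mean (p j))"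
  have "F \<subseteq> h ` (UNIV <+> {..<k})"
  proof
    fix X assume "X \<in> F"
    then consider i where "X = (\<lambda>\<omega>. fst \<omega> $ i)" | q where "q \<in> P'" "X = mean q"
      using P'(3) by blast
    then show "X \<in> h ` (UNIV <+> {..<k})"
    proof cases
      case 1
      then show ?thesis by (intro image_eqI[of _ _ "Inl i"]) (auto simp: h_def)
    next
      case 2
      then obtain j where "j < k" "q = p j" using p unfolding P_def by auto
      then show ?thesis using 2 by (intro image_eqI[of _ _ "Inr j"]) (auto simp: h_def)
    qed
  qed
  then have "units \<sigma> (units \<sigma> F) \<subseteq> units \<sigma> (units \<sigma> (h ` (UNIV <+> {..<k})))"
    by (intro units_mono)
  then have f_net: "f i \<in> net \<sigma> (h ` (UNIV <+> {..<k}))" for i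
    using F(3)[of i] affine_span_mono[THEN subsetD] unfolding net_def by metis
  obtain \<Psi> where \<Psi>: "neural_network \<sigma> (UNIV <+> {..<k}) UNIV \<Psi>"
    "\<And>z \<omega>. (\<forall>i\<in>UNIV <+> {..<k}. z i = h i \<omega>) \<Longrightarrow> \<forall>j\<in>UNIV. \<Psi> z j = f j \<omega>"
    using net_is_neural_network[of "UNIV <+> {..<k}" UNIV f \<sigma> h, OF _ _ f_net] by auto
  have "\<Psi> (case_sum (vec_nth x) (mean_embedding k (\<lambda>y. \<phi> (vec_nth y)) \<mu>)) i = f i (x, \<mu>)" for x \<mu> i
  proof -
    have "mean_embedding k (\<lambda>y. \<phi> (vec_nth y)) \<mu> j = (\<integral>y. p j y \<partial>\<mu>)" if "j < k" for j
    proof -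
      have "\<phi> (vec_nth y) j = p j y" for y using \<phi>(2)[of "vec_nth y" y] that by auto
      then show ?thesis using that by (simp add: mean_embedding_def)
    qed
    then have "\<forall>i\<in>UNIV <+> {..<k}.
        case_sum (vec_nth x) (mean_embedding k (\<lambda>y. \<phi> (vec_nth y)) \<mu>) i = h i (x, \<mu>)"
      by (auto simp: h_def mean_def)
    from \<Psi>(2)[OF this] show ?thesis by simp
  qed
  then show ?thesis using k \<phi>(1) \<Psi>(1) by blast
qed

theorem theorem2p2:
  fixes \<nu> :: "(real^'d) measure measure"
    and V :: "(real^'d) \<times> (real^'d) measure \<Rightarrow> real^'p"
    and \<sigma> :: "real \<Rightarrow> real" and \<epsilon> :: real
  assumes "\<sigma> \<in> {tanh, sigmoid, relu}"
    and "prob_space \<nu>" and "sets \<nu> = sets P2_borel"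
    and "continuous_map (prod_topology euclidean P2_topology) euclidean V"
    and "(\<integral>\<^sup>+\<mu>. sq_norm \<mu> (\<lambda>x. V (x, \<mu>)) \<partial>\<nu>) < \<infinity>"
    and "\<epsilon> > 0"
  shows "\<exists>(k::nat) (\<Psi> :: ('d + nat \<Rightarrow> real) \<Rightarrow> 'p \<Rightarrow> real) (\<phi> :: ('d \<Rightarrow> real) \<Rightarrow> nat \<Rightarrow> real).
    k \<ge> 1 \<and>
    neural_network \<sigma> (UNIV <+> {..<k}) UNIV \<Psi> \<and>
    neural_network \<sigma> UNIV {..<k} \<phi> \<and>
    (\<integral>\<^sup>+\<mu>. sq_norm \<mu> (\<lambda>x. V (x, \<mu>) -
        (\<chi> i. \<Psi> (case_sum (vec_nth x) (mean_embedding k (\<lambda>y. \<phi> (vec_nth y)) \<mu>)) i)) \<partial>\<nu>)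
      \<le> ennreal \<epsilon>"
proof -
  obtain s where squashing_net: "squashing s \<and>
      (\<forall>C :: ((real^'d) \<times> (real^'d) measure \<Rightarrow> real) set. net s C \<subseteq> net \<sigma> C) \<and>
      (\<forall>C :: (real^'d \<Rightarrow> real) set. net s C \<subseteq> net \<sigma> C)"
    using ex_squashing_net[OF assms(1)] by (rule exE)
  then have s: "squashing s" by (rule conjunct1)
  define M where "M = joint_law s \<nu>"
  have sets_M[measurable_cong]: "sets M = sets (feature_space s)"
    unfolding M_def by (rule sets_joint_law[OF s assms(2,3)])
  have int_M: "(\<integral>\<^sup>+\<omega>. f \<omega> \<partial>M) = (\<integral>\<^sup>+\<mu>. \<integral>\<^sup>+x. f (x, \<mu>) \<partial>\<mu> \<partial>\<nu>)" if "f \<in> borel_measurable M" for f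
    unfolding M_def
    by (rule nn_integral_joint_law[OF s assms(2,3)]) (use that measurable_cong_sets[OF sets_M refl] in blast)
  have V[measurable]: "V \<in> borel_measurable M"
    unfolding measurable_cong_sets[OF sets_M refl]
    by (rule continuous_map_P2_measurable[OF assms(4) fst_feature_space snd_feature_space[OF s]])
      (auto simp: space_feature_space)
  have Vi[measurable]: "(\<lambda>\<omega>. V \<omega> $ i) \<in> borel_measurable M" for i
    using measurable_compose[OF V, of "\<lambda>v. v $ i" borel] by (simp add: borel_measurable_continuous_onI continuous_intros)
  have gen: "sets M = sigma_sets (space M) {{\<omega>\<in>space M. a \<le> X \<omega>} | X a. X \<in> features s}"
    unfolding sets_M sets_feature_space using space_joint_law[OF s assms(2,3)] by (simp add: M_def)
  have "(\<integral>\<^sup>+\<omega>. ennreal ((V \<omega> $ i)\<^sup>2) \<partial>M) < \<infinity>" for i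
  proof -
    have "(\<integral>\<^sup>+\<omega>. ennreal ((V \<omega> $ i)\<^sup>2) \<partial>M) \<le> (\<integral>\<^sup>+\<omega>. ennreal ((norm (V \<omega>))\<^sup>2) \<partial>M)"
      using component_le_norm_cart by (intro nn_integral_mono ennreal_leI) (simp add: abs_le_square_iff[symmetric])
    also have "\<dots> = (\<integral>\<^sup>+\<mu>. sq_norm \<mu> (\<lambda>x. V (x, \<mu>)) \<partial>\<nu>)"
      unfolding sq_norm_def by (rule int_M) simp
    finally show ?thesis using assms(5) by (rule le_less_trans)
  qed
  then have approx: "L2_approx M (net s (features s)) (\<lambda>\<omega>. V \<omega> $ i)" for i
    using finite_measure_joint_law[OF s assms(2,3)]
    by (intro net_dense_L2[OF _ s gen Vi]) (auto simp: M_def)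
  define e where "e = \<epsilon> / real CARD('p)"
  have e: "e > 0" using assms(6) by (simp add: e_def)
  have "\<forall>i. \<exists>f. f \<in> net s (features s) \<and> (\<integral>\<^sup>+\<omega>. ennreal ((V \<omega> $ i - f \<omega>)\<^sup>2) \<partial>M) \<le> ennreal e"
  proof
    fix i
    obtain f where "f \<in> net s (features s)" "(\<integral>\<^sup>+\<omega>. ennreal ((V \<omega> $ i - f \<omega>)\<^sup>2) \<partial>M) \<le> ennreal e"
      by (rule L2_approxD[OF approx[of i] e])
    then show "\<exists>f. f \<in> net s (features s) \<and> (\<integral>\<^sup>+\<omega>. ennreal ((V \<omega> $ i - f \<omega>)\<^sup>2) \<partial>M) \<le> ennreal e"
      by (intro exI[of _ f] conjI)
  qed
  from choice[OF this] obtain f where "\<forall>i. f i \<in> net s (features s) \<and>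
      (\<integral>\<^sup>+\<omega>. ennreal ((V \<omega> $ i - f i \<omega>)\<^sup>2) \<partial>M) \<le> ennreal e" by (rule exE)
  then have f: "f i \<in> net s (features s)"
    "(\<integral>\<^sup>+\<omega>. ennreal ((V \<omega> $ i - f i \<omega>)\<^sup>2) \<partial>M) \<le> ennreal e" for i by simp_all
  have [measurable]: "f i \<in> borel_measurable M" for i
    unfolding measurable_cong_sets[OF sets_M refl] by (rule net_measurable[OF s f(1) features_measurable])
  have eq: "ennreal ((norm (V \<omega> - (\<chi> i. f i \<omega>)))\<^sup>2) = (\<Sum>i\<in>UNIV. ennreal ((V \<omega> $ i - f i \<omega>)\<^sup>2))" for \<omega>
    by (simp add: norm_vec_sq)
  have "(\<integral>\<^sup>+\<mu>. sq_norm \<mu> (\<lambda>x. V (x, \<mu>) - (\<chi> i. f i (x, \<mu>))) \<partial>\<nu>) =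
      (\<integral>\<^sup>+\<omega>. (\<Sum>i\<in>UNIV. ennreal ((V \<omega> $ i - f i \<omega>)\<^sup>2)) \<partial>M)"
    unfolding sq_norm_def eq by (rule int_M[symmetric]) measurable
  also have "\<dots> = (\<Sum>i\<in>UNIV. \<integral>\<^sup>+\<omega>. ennreal ((V \<omega> $ i - f i \<omega>)\<^sup>2) \<partial>M)"
    by (rule nn_integral_sum) measurable
  also have "\<dots> \<le> (\<Sum>i\<in>(UNIV :: 'p set). ennreal e)" by (intro sum_mono f(2))
  also have "\<dots> = ennreal \<epsilon>" using e by (simp add: e_def ennreal_of_nat_eq_real_of_nat flip: ennreal_mult)
  finally have bound: "(\<integral>\<^sup>+\<mu>. sq_norm \<mu> (\<lambda>x. V (x, \<mu>) - (\<chi> i. f i (x, \<mu>))) \<partial>\<nu>) \<le> ennreal \<epsilon>" .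
  have f_net: "f i \<in> net \<sigma> (features s)" for i
    using squashing_net f(1)[of i] by (meson subsetD)
  have sub: "net s (coords :: (real^'d \<Rightarrow> real) set) \<subseteq> net \<sigma> coords"
    using squashing_net by (elim conjE) (erule spec)
  obtain k :: nat and \<Psi> :: "('d + nat \<Rightarrow> real) \<Rightarrow> 'p \<Rightarrow> real" and \<phi> :: "('d \<Rightarrow> real) \<Rightarrow> nat \<Rightarrow> real"
    where nn: "k \<ge> 1 \<and> neural_network \<sigma> (UNIV <+> {..<k}) UNIV \<Psi> \<and> neural_network \<sigma> UNIV {..<k} \<phi> \<and>
      (\<forall>x \<mu> i. \<Psi> (case_sum (vec_nth x) (mean_embedding k (\<lambda>y. \<phi> (vec_nth y)) \<mu>)) i = f i (x, \<mu>))"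
    using networks_of_nets[of f, OF f_net sub] by (elim exE) (rule that)
  show ?thesis
    using nn bound by (intro exI[of _ k] exI[of _ \<Psi>] exI[of _ \<phi>]) simp
qed

end
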